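(* For every prime power $q>9$, $M(q+1,q-5)\ge \mathcal{T}_5(q)$, where $$\mathcal{T}_5(q)=\begin{cases} \frac12(q^5+2q^3-3q), & q\equiv 0 \pmod 3,\\ \frac12(q^5-q^4+q^3+q^2-2q), & q \text{ odd},\ q\equiv 1\pmod 3,\\ \frac12(q^5-q^4+3q^3+q^2-4q), & q \text{ even},\ q\equiv 1\pmod 3,\\ \frac12(q^5+q^4+q^3-q^2-2q), & q \text{ odd},\ q\equiv 2\pmod 3,\\ \frac12(q^5+q^4+3q^3-q^2-4q), & q \text{ even},\ q\equiv 2\pmod 3. \end{cases}$$
   Context: For permutations $\pi,\sigma$ of the same $n$ symbols, the Hamming distance $hd(\pi,\sigma)$ is the number of positions $x$ with $\pi(x)\ne\sigma(x)$. $M(n,D)$ is the maximum size of a set of permutations on $n$ symbols in which any two distinct permutations have Hamming distance at least $D$. Let $q$ be a prime power, $\mathbb{F}_q$ the field with $q$ elements and $\mathcal{P}^1(\mathbb{F}_q)=\mathbb{F}_q\cup\{\infty\}$. Let $V,U$ be nonzero polynomials over $\mathbb{F}_q$ with $\gcd(V,U)=1$, of degrees $v,u$ and leading coefficients $a_v,b_u$. The rational function $V(x)/U(x)$ is evaluated on $\mathcal{P}^1(\mathbb{F}_q)$ as follows: at $a\in\mathbb{F}_q$ its value is $V(a)/U(a)$, understood as $\infty$ if $U(a)=0$; at $\infty$ its value is $\infty$ if $v>u$, $0$ if $v<u$, and $a_v/b_v$ if $v=u$. It is a permutation rational function (PRF) if it permutes $\mathcal{P}^1(\mathbb{F}_q)$.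 $P_{v,u}(q)$ is the set of PRFs $V(x)/U(x)$ (as rational functions, so $V/U$ and $(cV)/(cU)$ with $c\in\mathbb{F}_q\setminus\{0\}$ are the same element) with $\deg V=v$ and $\deg U=u$, and $N_{v,u}(q)=|P_{v,u}(q)|$. $\mathcal{T}_5(q)=\sum N_{v,u}(q)$, the sum being over all pairs $(v,u)$ with $0\le v,u\le 3$. *)

theory Defs
  imports
    "HOL-Computational_Algebra.Computational_Algebra"
    "HOL-Number_Theory.Prime_Powers"
    "HOL-Combinatorics.Permutations"
    "HOL-Library.Cardinality"
begin

definition hamming_dist :: "nat \<Rightarrow> (nat \<Rightarrow> nat) \<Rightarrow> (nat \<Rightarrow> nat) \<Rightarrow> nat" where
  "hamming_dist n \<pi> \<sigma> = card {x. x < n \<and> \<pi> x \<noteq> \<sigma> x}"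

(* The n symbols are 0, ..., n - 1. *)
definition perm_code :: "nat \<Rightarrow> nat \<Rightarrow> (nat \<Rightarrow> nat) set \<Rightarrow> bool" where
  "perm_code n D C \<longleftrightarrow>
     (\<forall>\<pi>\<in>C. \<pi> permutes {..<n}) \<and>
     (\<forall>\<pi>\<in>C. \<forall>\<sigma>\<in>C. \<pi> \<noteq> \<sigma> \<longrightarrow> D \<le> hamming_dist n \<pi> \<sigma>)"

(* The maximum ranges over a finite nonempty set: there are only finitely many
   permutations of n symbols, and the empty set is a code. *)
definition max_perm_code :: "nat \<Rightarrow> nat \<Rightarrow> nat" where
  "max_perm_code n D = Max {card C | C. perm_code n D C}"

(* Value of V/U on the projective line, which is represented by the type
   'a option with None as the point at infinity. *)
fun ratfun_eval :: "'a::field poly \<Rightarrow> 'a poly \<Rightarrow> 'a option \<Rightarrow> 'a option" where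
  "ratfun_eval V U (Some a) =
     (if poly U a = 0 then None else Some (poly V a / poly U a))"
| "ratfun_eval V U None =
     (if degree V > degree U then None
      else if degree V < degree U then Some 0
      else Some (lead_coeff V / lead_coeff U))"

(* Rational functions are elements of the fraction field of the polynomial ring, so
   V/U and (cV)/(cU) are the same element; a representation in lowest terms
   is unique up to such a constant c. *)
definition PRF :: "nat \<Rightarrow> nat \<Rightarrow> 'a::{field,finite} poly fract set" where
  "PRF v u = {Fract V U | V U.
     V \<noteq> 0 \<and> U \<noteq> 0 \<and> coprime V U \<and> degree V = v \<and> degree U = u \<and>
     bij (ratfun_eval V U)}"

definition N_prf :: "'a::{field,finite} itself \<Rightarrow> nat \<Rightarrow> nat \<Rightarrow> nat" where
  "N_prf _ v u = card (PRF v u :: 'a poly fract set)"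

definition T5 :: "'a::{field,finite} itself \<Rightarrow> nat" where
  "T5 F = (\<Sum>(v, u)\<in>{0..3} \<times> {0..3}. N_prf F v u)"

end

theory Submission
  imports Defs
begin

text \<open>Every reduced rational function of degree at most 3 is either \<open>a f\<close> or \<open>a + e / f\<close> for a
  unique \<open>f = V/U\<close> with \<open>V\<close>, \<open>U\<close> monic and \<open>f \<infinity> = \<infinity>\<close>, so only such \<open>f\<close> have to be counted.
  If \<open>f\<close> permutes the projective line, \<open>U\<close> has no root, hence \<open>U = 1\<close> or \<open>U\<close> is an irreducible
  quadratic. Polynomials are settled by Hermite's power sums. For \<open>U = x\<^sup>2 + u x + w\<close> and
  \<open>f = x + b + r/U\<close> the conditions \<open>\<Sum>f\<^sup>k = 0\<close> for \<open>k \<le> 3\<close> already leave only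
  \<open>r = (4w - u\<^sup>2) U'\<close>, and this \<open>r\<close> does give a permutation, because \<open>(f x - f y) / (x - y)\<close> is
  then, up to nonzero factors, a norm from the quadratic extension. So each irreducible quadratic
  contributes exactly \<open>q\<close> functions, one for each \<open>b\<close>. Two distinct functions agree in at most six points of the
  projective line, which gives the code.\<close>

text \<open>A sum over the field reads off the coefficient of X^(q-1) of a polynomial, so the
  obstacle is to sum powers of rational functions without passing to the quadratic extension. The
  way round: \<open>U\<close> divides X^q + X + u, and the quotient is a polynomial of degree q - 2
  that agrees with U'/U on the field; its moments are visible in its top coefficients. Parity
  decides how many power sums are needed. For odd q the first two suffice. For even q the derivative
  of \<open>U\<close> is the constant u and a sum of squares is the square of the sum, so the second
  power sum repeats the first and the third is used, which requires 3 < q - 1. Each f fixing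
  infinity yields q - 1 functions a f and q (q - 1) functions a + e/f, whence a factor q^2 - 1; the
  q (q - 1)/2 irreducible quadratics give the term q^2 (q - 1)/2. The case distinction on q comes
  from the polynomials of degree two (parity) and three (residue modulo 3). Six is the degree bound
  for the cross product of two fractions of degree at most 3, and q + 1 - 6 = q - 5.\<close>

section \<open>Power sums over a finite field\<close>

text \<open>The library's \<open>finite_field_power_card_eq_same\<close> is stated for the class
  \<open>finite_field\<close>, which the sort \<open>{field, finite}\<close> does not syntactically imply.\<close>

lemma power_card_eq_self:
  fixes x :: "'a::{field,finite}"
  shows "x ^ CARD('a) = x"
proof (cases "x = 0")
  case False
  have "bij_betw ((*) x) (UNIV - {0}) (UNIV - {0})"
    by (rule bij_betw_byWitness[of _ "\<lambda>y. y / x"]) (use False in auto)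
  then have "(\<Prod>y\<in>UNIV - {0}. x * y) = \<Prod>(UNIV - {0::'a})"
    by (rule prod.reindex_bij_betw)
  then have "x ^ card (UNIV - {0::'a}) = 1"
    by (simp add: prod.distrib)
  then have "x * x ^ (CARD('a) - 1) = x"
    by (simp add: card_Diff_singleton)
  then show ?thesis
    by (simp flip: power_Suc)
qed (simp add: power_0_left)

lemma power_card_minus_1:
  fixes x :: "'a::{field,finite}"
  assumes "x \<noteq> 0"
  shows "x ^ (CARD('a) - 1) = 1"
proof -
  have "x * x ^ (CARD('a) - 1) = x * 1"
    using power_card_eq_self[of x] by (simp flip: power_Suc)
  then show ?thesis
    using assms by simp
qed

lemma of_nat_card_eq_0: "of_nat (CARD('a::{field,finite})) = (0::'a)"
proof -
  have "bij (\<lambda>x::'a. x + 1)"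
    by (rule bij_betw_byWitness[of _ "\<lambda>y. y - 1"]) auto
  then have "(\<Sum>x\<in>UNIV. x + 1) = (\<Sum>x\<in>(UNIV::'a set). x)"
    by (rule sum.reindex_bij_betw)
  then show ?thesis
    by (simp add: sum.distrib)
qed

text \<open>X^k - 1 has at most k < q - 1 roots, so some nonzero a has a^k \<noteq> 1;
  multiplication by a permutes the field but scales the sum by a^k. No primitive root is
  needed.\<close>

lemma sum_power_less_card:
  assumes "k < CARD('a::{field,finite}) - 1"
  shows "(\<Sum>x\<in>(UNIV::'a set). x ^ k) = 0"
proof (cases "k = 0")
  case True
  then show ?thesis
    by (simp add: of_nat_card_eq_0)
next
  case False
  define p :: "'a poly" where "p = monom 1 k - 1"
  have "coeff p k = 1"
    using False by (simp add: p_def)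
  then have "p \<noteq> 0"
    by auto
  have "degree p \<le> k"
    unfolding p_def by (rule degree_diff_le) (auto simp: degree_monom_eq)
  then have "card {x. poly p x = 0} \<le> k"
    using card_poly_roots_bound[OF \<open>p \<noteq> 0\<close>] by simp
  moreover have "card (UNIV - {0::'a}) = CARD('a) - 1"
    by (simp add: card_Diff_singleton)
  ultimately have "\<not> UNIV - {0} \<subseteq> {x. poly p x = 0}"
    using assms card_mono[of "{x. poly p x = 0}" "UNIV - {0}"] by auto
  then obtain a where "a \<in> UNIV - {0}" "a \<notin> {x. poly p x = 0}"
    by blast
  then have a: "a \<noteq> 0" "a ^ k \<noteq> 1"
    by (simp_all add: p_def poly_monom)
  have "bij ((*) a)"
    by (rule bij_betw_byWitness[of _ "\<lambda>y. y / a"]) (use a in auto)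
  then have "(\<Sum>x\<in>UNIV. (a * x) ^ k) = (\<Sum>x\<in>(UNIV::'a set). x ^ k)"
    by (rule sum.reindex_bij_betw)
  then have "a ^ k * (\<Sum>x\<in>UNIV. x ^ k) = (\<Sum>x\<in>(UNIV::'a set). x ^ k)"
    by (simp add: power_mult_distrib sum_distrib_left)
  then show ?thesis
    using a by simp
qed

lemma sum_power_card_minus_1:
  assumes "CARD('a::{field,finite}) > 1"
  shows "(\<Sum>x\<in>(UNIV::'a set). x ^ (CARD('a) - 1)) = -1"
proof -
  have "(\<Sum>x\<in>(UNIV::'a set). x ^ (CARD('a) - 1)) = (\<Sum>x\<in>UNIV - {0::'a}. 1)"
    using assms by (intro sum.mono_neutral_cong_right) (auto simp: power_card_minus_1 power_0_left simp del: One_nat_def)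
  also have "\<dots> = of_nat (CARD('a) - 1)"
    by (simp add: card_Diff_singleton)
  also have "\<dots> = of_nat CARD('a) - (1::'a)"
    using assms by (simp add: of_nat_diff)
  finally show ?thesis
    by (simp add: of_nat_card_eq_0)
qed

text \<open>The range up to q + 1 covers every later use: the largest degree is that of a cubic
  raised to the power (q + 1)/3. The exponents q and q + 1 reduce to 1 and 2, which lie below q - 1
  because q > 3.\<close>

lemma sum_power_le_Suc_card:
  assumes "CARD('a::{field,finite}) > 3" and "k \<le> CARD('a) + 1"
  shows "(\<Sum>x\<in>(UNIV::'a set). x ^ k) = (if k = CARD('a) - 1 then -1 else 0)"
proof -
  consider "k < CARD('a) - 1" | "k = CARD('a) - 1" | "k = CARD('a)" | "k = CARD('a) + 1"
    using assms by linarith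
  then show ?thesis
  proof cases
    case 3
    then show ?thesis
      using assms sum_power_less_card[where 'a='a, of 1] by (simp add: power_card_eq_self)
  next
    case 4
    then show ?thesis
      using assms sum_power_less_card[where 'a='a, of 2]
      by (simp add: power_card_eq_self power2_eq_square)
  qed (use assms in \<open>simp_all add: sum_power_less_card sum_power_card_minus_1 del: One_nat_def\<close>)
qed

lemma sum_poly_eq_coeff:
  fixes p :: "'a::{field,finite} poly"
  assumes "CARD('a) > 3" and "degree p \<le> CARD('a) + 1"
  shows "(\<Sum>x\<in>UNIV. poly p x) = - coeff p (CARD('a) - 1)"
proof -
  have "poly p x = (\<Sum>i\<le>CARD('a) + 1. coeff p i * x ^ i)" for x
    unfolding poly_altdef using assms(2)
    by (intro sum.mono_neutral_left) (auto simp: coeff_eq_0)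
  then have "(\<Sum>x\<in>UNIV. poly p x) = (\<Sum>x\<in>UNIV. \<Sum>i\<le>CARD('a) + 1. coeff p i * x ^ i)"
    by simp
  also have "\<dots> = (\<Sum>i\<le>CARD('a) + 1. coeff p i * (\<Sum>x\<in>UNIV. x ^ i))"
    by (subst sum.swap) (simp only: sum_distrib_left)
  also have "\<dots> = (\<Sum>i\<le>CARD('a) + 1. if i = CARD('a) - 1 then - coeff p i else 0)"
    using assms(1) by (intro sum.cong) (auto simp: sum_power_le_Suc_card)
  finally show ?thesis
    by simp
qed

lemma sum_power_bij:
  fixes f :: "'a::{field,finite} \<Rightarrow> 'a"
  assumes "bij f" and "k < CARD('a) - 1"
  shows "(\<Sum>x\<in>UNIV. f x ^ k) = 0"
  using sum.reindex_bij_betw[OF assms(1), of "\<lambda>x. x ^ k"] sum_power_less_card[OF assms(2)] by simp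

section \<open>The characteristic\<close>

lemma prime_CHAR_finite_field: "prime CHAR('a::{field,finite})"
  by (intro prime_CHAR_semidom finite_imp_CHAR_pos) simp

lemma card_eq_CHAR_power:
  assumes "primepow CARD('a::{field,finite})"
  obtains k where "k > 0" and "CARD('a) = CHAR('a) ^ k"
proof -
  obtain s k where s: "prime s" "k > 0" "CARD('a) = s ^ k"
    using assms by (auto simp: primepow_def)
  have "CHAR('a) dvd CARD('a)"
    using of_nat_card_eq_0[where 'a='a] by (simp add: of_nat_eq_0_iff_char_dvd)
  then have "CHAR('a) = s"
    using s prime_CHAR_finite_field[where 'a='a] by (metis prime_dvd_power primes_dvd_imp_eq)
  then show thesis
    using s that by blast
qed

lemma of_nat_prime_eq_0_iff:
  assumes "primepow CARD('a::{field,finite})" and "prime r"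
  shows "of_nat r = (0::'a) \<longleftrightarrow> r dvd CARD('a)"
proof -
  obtain k where k: "k > 0" "CARD('a) = CHAR('a) ^ k"
    using card_eq_CHAR_power[OF assms(1)] .
  have "r dvd CARD('a) \<longleftrightarrow> r dvd CHAR('a)"
    using k assms(2) by (metis dvd_power dvd_trans prime_dvd_power)
  also have "\<dots> \<longleftrightarrow> CHAR('a) dvd r"
    using assms(2) prime_CHAR_finite_field[where 'a='a] primes_dvd_imp_eq by auto
  finally show ?thesis
    by (simp add: of_nat_eq_0_iff_char_dvd)
qed

lemma two_eq_0_iff:
  assumes "primepow CARD('a::{field,finite})"
  shows "(2::'a) = 0 \<longleftrightarrow> even CARD('a)"
  using of_nat_prime_eq_0_iff[OF assms two_is_prime_nat] by simp

lemma three_eq_0_iff: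
  assumes "primepow CARD('a::{field,finite})"
  shows "(3::'a) = 0 \<longleftrightarrow> CARD('a) mod 3 = 0"
proof -
  have "prime (3::nat)"
    by simp
  from of_nat_prime_eq_0_iff[OF assms this] show ?thesis
    by (simp add: mod_eq_0_iff_dvd)
qed

text \<open>Needed to see that the q-th power of a quadratic over the field is the same quadratic
  evaluated at X^q.\<close>

lemma poly_add_power_card:
  fixes p q :: "'a::{field,finite} poly"
  assumes "primepow CARD('a)"
  shows "(p + q) ^ CARD('a) = p ^ CARD('a) + q ^ CARD('a)"
proof -
  obtain k where "CARD('a) = CHAR('a) ^ k"
    using card_eq_CHAR_power[OF assms] .
  moreover have "CHAR('a poly) = CHAR('a)"
    by (intro CHAR_eqI) (auto simp: of_nat_poly of_nat_eq_0_iff_char_dvd)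
  ultimately show ?thesis
    using prime_CHAR_finite_field[where 'a='a] by (intro freshmans_dream'[where n = k]) auto
qed

lemma double_char_2:
  assumes "(2::'a::field) = 0"
  shows "x + x = (0::'a)"
  using assms by (metis mult_2 mult_zero_left)

text \<open>Additivity of Frobenius. In characteristic 2 the second power sum therefore carries no
  information beyond the first.\<close>

lemma sum_square_char_2:
  assumes "(2::'a::{field,finite}) = 0"
  shows "(\<Sum>x\<in>A. (g x :: 'a)\<^sup>2) = (\<Sum>x\<in>A. g x)\<^sup>2"
  by (induction A rule: infinite_finite_induct) (auto simp: power2_sum assms)

lemma square_bij_char_2:
  assumes "(2::'a::{field,finite}) = 0"
  shows "bij (\<lambda>x::'a. x\<^sup>2)"
proof -
  have "x = y" if "x\<^sup>2 = y\<^sup>2" for x y :: 'a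
  proof -
    have "(x - y)\<^sup>2 = 0"
      using that assms double_char_2[OF assms, of "y\<^sup>2"] by (simp add: power2_diff)
    then show ?thesis by simp
  qed
  then have "inj (\<lambda>x::'a. x\<^sup>2)"
    by (auto intro: injI)
  then show ?thesis
    by (simp add: bij_def finite_UNIV_inj_surj)
qed

section \<open>Quadratic denominators\<close>

lemma prime_elem_quadratic:
  fixes u w :: "'a::field"
  assumes nr: "\<And>x. x\<^sup>2 + u * x + w \<noteq> 0"
  shows "prime_elem [:w, u, 1:]"
proof -
  let ?U = "[:w, u, 1:]"
  have nr': "poly ?U x \<noteq> 0" for x
    using nr[of x] by (simp add: power2_eq_square algebra_simps)
  have no_linear: "degree p \<noteq> 1" if "p dvd ?U" for p
  proof
    assume "degree p = 1"
    then obtain a b where p: "p = [:a, b:]" "b \<noteq> 0"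
      by (metis degree1_coeffs)
    then have "poly p (- a / b) = 0"
      by simp
    with that nr' show False
      by (metis dvdE mult_zero_left poly_mult)
  qed
  have "irreducible ?U"
  proof (rule irreducibleI)
    fix p r assume pr: "?U = p * r"
    then have "p \<noteq> 0" "r \<noteq> 0"
      by auto
    then have "degree p + degree r = 2"
      using degree_mult_eq[of p r] by (simp flip: pr)
    moreover have "degree p \<noteq> 1" "degree r \<noteq> 1"
      using no_linear pr by auto
    ultimately have "degree p = 0 \<or> degree r = 0"
      by linarith
    then show "is_unit p \<or> is_unit r"
      using \<open>p \<noteq> 0\<close> \<open>r \<noteq> 0\<close> by (simp add: is_unit_iff_degree)
  qed (auto simp: is_unit_iff_degree)
  then show ?thesis
    by (rule field_poly_irreducible_imp_prime)
qed

text \<open>Frobenius exchanges the two roots of \<open>U\<close>, so \<open>X\<^sup>q\<close> is congruent to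
  \<open>- u - X\<close> modulo \<open>U\<close>; the cofactor \<open>H\<close> below interpolates \<open>U'/U\<close> on the field.\<close>

lemma quadratic_dvd_power_card:
  fixes u w :: "'a::{field,finite}"
  assumes pp: "primepow CARD('a)" and q: "CARD('a) > 3"
    and nr: "\<And>x. x\<^sup>2 + u * x + w \<noteq> 0"
  shows "[:w, u, 1:] dvd monom 1 CARD('a) + [:u, 1:]"
proof -
  define q where "q = CARD('a)"
  define U where "U = [:w, u, 1:]"
  define X :: "'a poly" where "X = [:0, 1:]"
  have Xq: "X ^ q = monom 1 q"
    by (simp add: X_def monom_altdef)
  have U: "U = X\<^sup>2 + ([:u:] * X + [:w:])"
    by (simp add: U_def X_def power2_eq_square)
  have const: "[:c:] ^ q = [:c:]" for c :: 'a
    unfolding q_def by (simp add: poly_const_pow power_card_eq_self)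
  have "U ^ q = (X\<^sup>2) ^ q + (([:u:] * X) ^ q + [:w:] ^ q)"
    unfolding U q_def by (simp only: poly_add_power_card[OF pp])
  also have "\<dots> = (X ^ q)\<^sup>2 + [:u:] * X ^ q + [:w:]"
    by (simp only: power_mult_distrib[of _ X] const power_mult[symmetric] mult.commute[of 2]
        add.assoc)
  \<comment> \<open>The difference is U(X^q) - U(X), which contains the factor X^q - X.\<close>
  finally have "U ^ q - U = (X ^ q - X) * (X ^ q + X + [:u:])"
    unfolding U by (simp add: algebra_simps power2_eq_square)
  moreover have "U dvd U ^ q - U"
    using q by (intro dvd_diff dvd_power) (auto simp: q_def)
  moreover have "prime_elem U"
    unfolding U_def by (rule prime_elem_quadratic[OF nr])
  \<comment> \<open>The cofactor would have degree below q and yet vanish at all q elements, because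
    X^q - X does and \<open>U\<close> has no zero there.\<close>
  moreover have "\<not> U dvd X ^ q - X"
  proof
    assume "U dvd X ^ q - X"
    then obtain K where K: "X ^ q - X = U * K"
      by (auto elim: dvdE)
    have "degree (X ^ q - X) = q"
      using q unfolding Xq diff_conv_add_uminus
      by (subst degree_add_eq_left) (auto simp: degree_monom_eq q_def X_def)
    then have "X ^ q - X \<noteq> 0"
      using q by (auto simp: q_def)
    then have "K \<noteq> 0" "U \<noteq> 0"
      using K by auto
    then have "degree K < q"
      using K \<open>degree (X ^ q - X) = q\<close> degree_mult_eq[of U K] by (simp add: U_def)
    have "poly K x = 0" for x
    proof -
      have "poly (X ^ q - X) x = 0"
        by (simp add: X_def q_def power_card_eq_self)
      moreover have "poly U x \<noteq> 0"
        using nr[of x] by (simp add: U_def power2_eq_square algebra_simps)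
      ultimately show ?thesis
        unfolding K by simp
    qed
    then have "q \<le> degree K"
      using card_poly_roots_bound[OF \<open>K \<noteq> 0\<close>] by (simp add: q_def)
    with \<open>degree K < q\<close> show False by simp
  qed
  ultimately have "U dvd X ^ q + X + [:u:]"
    by (metis prime_elem_dvd_mult_iff)
  then show ?thesis
    unfolding Xq by (simp add: X_def U_def q_def add.assoc)
qed

text \<open>On the field X^q + X + u takes the value 2x + u, so \<open>H\<close> is U'/U there. The
  three moments are minus the coefficients of X^(q-1) in H, X H and X^2 H, that is, of X^(q-1),
  X^(q-2) and X^(q-3) in \<open>H\<close>.\<close>

lemma quadratic_log_deriv_sums:
  fixes u w :: "'a::{field,finite}"
  assumes pp: "primepow CARD('a)" and q: "CARD('a) > 3"
    and nr: "\<And>x. x\<^sup>2 + u * x + w \<noteq> 0"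
  obtains h :: "'a \<Rightarrow> 'a"
    where "\<And>x. (x\<^sup>2 + u * x + w) * h x = 2 * x + u"
      and "(\<Sum>x\<in>UNIV. h x) = 0"
      and "(\<Sum>x\<in>UNIV. x * h x) = -1"
      and "(\<Sum>x\<in>UNIV. x\<^sup>2 * h x) = u"
proof -
  obtain m where m: "CARD('a) = m + 3"
    using q by (metis add.commute le_add_diff_inverse less_imp_le_nat)
  obtain H where H: "monom 1 CARD('a) + [:u, 1:] = [:w, u, 1:] * H"
    using quadratic_dvd_power_card[OF pp q nr] by (auto elim: dvdE)
  have "degree (monom 1 CARD('a) + [:u, 1:]) = m + 3"
    using q unfolding m by (subst degree_add_eq_left) (auto simp: degree_monom_eq)
  moreover from this have "H \<noteq> 0"
    using H by auto
  ultimately have deg: "degree H = m + 1"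
    using H degree_mult_eq[of "[:w, u, 1:]" H] by simp
  have c: "coeff (monom 1 CARD('a) + [:u, 1:]) k = coeff ([:w, u, 1:] * H) k" for k
    using H by simp
  have c1: "coeff H (Suc m) = 1"
    using c[of "m + 3"] deg
    by (simp add: m coeff_pCons coeff_eq_0 eval_nat_numeral split: nat.splits)
  \<comment> \<open>X^q + X + u has no term of degree q - 1, since q > 3; the product contributes
    \<open>coeff H m + u * coeff H (Suc m)\<close> there.\<close>
  have c0: "coeff H m = - u"
    using c[of "m + 2"] deg c1 q
    by (simp add: m coeff_pCons coeff_eq_0 eval_nat_numeral eq_neg_iff_add_eq_0 add.commute
        split: nat.splits)
  show thesis
  proof (rule that)
    fix x
    have "poly (monom 1 CARD('a) + [:u, 1:]) x = poly ([:w, u, 1:] * H) x"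
      by (simp only: H)
    then show "(x\<^sup>2 + u * x + w) * poly H x = 2 * x + u"
      by (simp add: poly_monom power_card_eq_self power2_eq_square algebra_simps)
  next
    show "(\<Sum>x\<in>UNIV. poly H x) = 0"
      using deg q by (simp add: sum_poly_eq_coeff m coeff_eq_0)
    have "(\<Sum>x\<in>UNIV. poly ([:0, 1:] * H) x) = -1"
      using deg q c1 degree_mult_le[of "[:0, 1:]" H]
      by (subst sum_poly_eq_coeff) (simp_all add: m)
    then show "(\<Sum>x\<in>UNIV. x * poly H x) = -1"
      by simp
    have "(\<Sum>x\<in>UNIV. poly ([:0, 0, 1:] * H) x) = u"
      using deg q c0 degree_mult_le[of "[:0, 0, 1:]" H]
      by (subst sum_poly_eq_coeff) (simp_all add: m)
    then show "(\<Sum>x\<in>UNIV. x\<^sup>2 * poly H x) = u"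
      by (simp add: power2_eq_square mult.assoc)
  qed
qed

lemma sum_id_eq_0:
  assumes "CARD('a::{field,finite}) > 3"
  shows "(\<Sum>x\<in>UNIV. x) = (0::'a)" and "(\<Sum>x\<in>UNIV. x\<^sup>2) = (0::'a)"
  using assms sum_power_less_card[where 'a='a, of 1] sum_power_less_card[where 'a='a, of 2]
  by simp_all

text \<open>A vanishing discriminant would make -u/2 a double root.\<close>

lemma quadratic_disc_nonzero_odd:
  fixes u w :: "'a::field"
  assumes two: "(2::'a) \<noteq> 0" and nr: "\<And>x. x\<^sup>2 + u * x + w \<noteq> 0"
  shows "4 * w - u\<^sup>2 \<noteq> 0"
proof
  assume eq: "4 * w - u\<^sup>2 = 0"
  define v where "v = u / 2"
  have u: "u = 2 * v"
    using two by (simp add: v_def)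
  have "2 * (2 * (w - v\<^sup>2)) = 0"
    using eq unfolding u by (simp add: power2_eq_square algebra_simps)
  then have "w - v\<^sup>2 = 0"
    using two by (simp only: mult_eq_0_iff) blast
  then have "w = v\<^sup>2"
    by simp
  then have "(- v)\<^sup>2 + u * (- v) + w = 0"
    unfolding u by (simp add: power2_eq_square)
  with nr show False by blast
qed

text \<open>Squaring is onto in characteristic 2, so x^2 + w always has a root.\<close>

lemma quadratic_linear_coeff_nonzero_even:
  fixes u w :: "'a::{field,finite}"
  assumes two: "(2::'a) = 0" and nr: "\<And>x. x\<^sup>2 + u * x + w \<noteq> 0"
  shows "u \<noteq> 0"
proof
  assume "u = 0"
  obtain x where "x\<^sup>2 = w"
    using square_bij_char_2[OF two] by (metis bij_pointE)
  then show False
    using \<open>u = 0\<close> double_char_2[OF two, of w] nr[of x] by simp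
qed

text \<open>With \<open>k\<close> and \<open>d\<close> as in the proof, \<open>k\<^sup>2 - u k d + w d\<^sup>2\<close> is the norm of \<open>x y - \<alpha> x - \<beta> y + u\<^sup>2 - 3 w\<close>,
  where \<open>\<alpha>\<close> and \<open>\<beta>\<close> are the conjugate roots of \<open>x\<^sup>2 + u x + w\<close>.\<close>

lemma quadratic_perm_sufficient:
  fixes u w :: "'a::{field,finite}"
  defines "t \<equiv> 4 * w - u\<^sup>2"
  assumes nr: "\<And>x. x\<^sup>2 + u * x + w \<noteq> 0"
  shows "bij (\<lambda>x. x + t * (2 * x + u) / (x\<^sup>2 + u * x + w))"
proof -
  let ?U = "\<lambda>x. x\<^sup>2 + u * x + w"
  have "x = y" if eq: "x + t * (2 * x + u) / ?U x = y + t * (2 * y + u) / ?U y" for x y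
  proof (rule ccontr)
    assume "x \<noteq> y"
    define k d where "k = x * y + u\<^sup>2 - 3 * w + u * x" and "d = x - y"
    have "x * (?U x * ?U y) + t * (2 * x + u) * ?U y = y * (?U x * ?U y) + t * (2 * y + u) * ?U x"
      using eq nr[of x] nr[of y] by (simp add: field_simps)
    moreover have "d * (k\<^sup>2 - u * k * d + w * d\<^sup>2) = (x * (?U x * ?U y) + t * (2 * x + u) * ?U y)
        - (y * (?U x * ?U y) + t * (2 * y + u) * ?U x)"
      unfolding k_def d_def t_def by (simp add: algebra_simps power2_eq_square)
    ultimately have "d * (k\<^sup>2 - u * k * d + w * d\<^sup>2) = 0"
      by simp
    then have "k\<^sup>2 - u * k * d + w * d\<^sup>2 = 0" and "d \<noteq> 0"
      using \<open>x \<noteq> y\<close> by (auto simp: d_def)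
    \<comment> \<open>The quadratic form in k and d is d^2 times the value of \<open>U\<close> at
      -k/d.\<close>
    then have "?U (- k / d) = 0"
      by (simp add: field_simps power2_eq_square)
    with nr show False by blast
  qed
  then have "inj (\<lambda>x. x + t * (2 * x + u) / ?U x)"
    by (auto intro: injI)
  then show ?thesis
    by (simp add: bij_def finite_UNIV_inj_surj)
qed

text \<open>Both \<open>x + a U'/U\<close> and the permutation of the previous lemma have vanishing power sums.
  Comparing them avoids computing the sum of \<open>(U'/U)\<^sup>2\<close> (and of \<open>(U'/U)\<^sup>3\<close> in
  characteristic 2).\<close>

lemma quadratic_perm_necessary_odd:
  fixes u w r0 r1 :: "'a::{field,finite}"
  assumes pp: "primepow CARD('a)" and q: "CARD('a) > 3" and two: "(2::'a) \<noteq> 0"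
    and nr: "\<And>x. x\<^sup>2 + u * x + w \<noteq> 0"
    and nz: "r1 \<noteq> 0 \<or> r0 \<noteq> 0"
    and bij: "bij (\<lambda>x. x + (r1 * x + r0) / (x\<^sup>2 + u * x + w))"
  shows "r1 = 2 * (4 * w - u\<^sup>2) \<and> r0 = u * (4 * w - u\<^sup>2)"
proof -
  let ?U = "\<lambda>x. x\<^sup>2 + u * x + w"
  define t where "t = 4 * w - u\<^sup>2"
  obtain h where h: "\<And>x. ?U x * h x = 2 * x + u" and h0: "(\<Sum>x\<in>UNIV. h x) = 0"
    and h1: "(\<Sum>x\<in>UNIV. x * h x) = -1"
    using quadratic_log_deriv_sums[OF pp q nr] by metis
  have hU: "(2 * x + u) / ?U x = h x" for x
    using h[of x] nr[of x] by (simp add: field_simps)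
  have t: "t \<noteq> 0"
    unfolding t_def by (rule quadratic_disc_nonzero_odd[OF two nr])
  \<comment> \<open>The numerator is split as a U' + c, which is possible because 2 is invertible.
    The first power sum will remove c, the second will determine a.\<close>
  define a c where "a = r1 / 2" and "c = r0 - a * u"
  have r: "r1 * x + r0 = a * (2 * x + u) + c" for x
    using two by (simp add: a_def c_def algebra_simps)
  \<comment> \<open>The identity U'^2 = 4 U - t expresses the unknown sum of 1/U through the known
    moments of \<open>h\<close>.\<close>
  have "(2 * x + u) * h x = 4 - t / ?U x" for x
  proof -
    have "(2 * x + u) * h x = (2 * x + u)\<^sup>2 / ?U x"
      by (simp add: hU[symmetric] power2_eq_square)
    also have "(2 * x + u)\<^sup>2 = 4 * ?U x - t"
      by (simp add: t_def power2_eq_square algebra_simps)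
    finally show ?thesis
      by (simp only: diff_divide_distrib nonzero_mult_div_cancel_right[OF nr])
  qed
  then have "(\<Sum>x\<in>UNIV. (2 * x + u) * h x) = (\<Sum>x\<in>UNIV. 4 - t * (1 / ?U x))"
    by simp
  also have "\<dots> = - (t * (\<Sum>x\<in>UNIV. 1 / ?U x))"
    by (simp add: sum_subtractf of_nat_card_eq_0 sum_distrib_left)
  also have "(\<Sum>x\<in>UNIV. (2 * x + u) * h x) = 2 * (\<Sum>x\<in>UNIV. x * h x) + u * (\<Sum>x\<in>UNIV. h x)"
    by (simp add: sum.distrib sum_distrib_left algebra_simps)
  finally have inv_sum: "t * (\<Sum>x\<in>UNIV. 1 / ?U x) = 2"
    using h0 h1 by simp
  have f: "x + (r1 * x + r0) / ?U x = x + a * h x + c * (1 / ?U x)" for x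
    by (simp add: r add_divide_distrib[of _ c] hU[symmetric])
  have "(\<Sum>x\<in>UNIV. (x + (r1 * x + r0) / ?U x) ^ 1) = 0"
    using q by (intro sum_power_bij[OF bij]) simp
  then have "(\<Sum>x\<in>UNIV. x) + a * (\<Sum>x\<in>UNIV. h x) + c * (\<Sum>x\<in>UNIV. 1 / ?U x) = 0"
    by (simp only: f power_one_right sum.distrib sum_distrib_left)
  then have "c * (\<Sum>x\<in>UNIV. 1 / ?U x) = 0"
    by (simp only: h0 sum_id_eq_0[OF q] mult_zero_right add_0)
  then have "c = 0"
    using inv_sum two by auto
  have square_sum: "2 * b = b\<^sup>2 * (\<Sum>x\<in>UNIV. (h x)\<^sup>2)" if "bij (\<lambda>x. x + b * h x)" for b
  proof -
    have "(\<Sum>x\<in>UNIV. (x + b * h x)\<^sup>2) = 0"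
      using q by (intro sum_power_bij[OF that]) simp
    moreover have "(x + b * h x)\<^sup>2 = x\<^sup>2 + 2 * b * (x * h x) + b\<^sup>2 * (h x)\<^sup>2" for x
      by (simp add: power2_eq_square algebra_simps)
    ultimately show ?thesis
      using h1 by (simp add: sum.distrib sum_id_eq_0[OF q] flip: sum_distrib_left)
  qed
  have "bij (\<lambda>x. x + a * h x)"
    using bij unfolding f \<open>c = 0\<close> by simp
  from square_sum[OF this] have "2 * a = a\<^sup>2 * (\<Sum>x\<in>UNIV. (h x)\<^sup>2)" .
  moreover have "a \<noteq> 0"
    using nz \<open>c = 0\<close> two by (auto simp: a_def c_def)
  moreover have "bij (\<lambda>x. x + t * h x)"
    using quadratic_perm_sufficient[OF nr] by (simp add: t_def hU flip: times_divide_eq_right)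
  from square_sum[OF this] have "2 * t = t\<^sup>2 * (\<Sum>x\<in>UNIV. (h x)\<^sup>2)" .
  \<comment> \<open>The sum of squares of \<open>h\<close> stays unknown, but a and t satisfy the
    same linear equation with it, and 2 \<noteq> 0 shows that it is nonzero.\<close>
  ultimately have "a * (\<Sum>x\<in>UNIV. (h x)\<^sup>2) = 2" "t * (\<Sum>x\<in>UNIV. (h x)\<^sup>2) = 2"
    using t by (simp_all add: power2_eq_square)
  then have "a = t"
    using two by (metis mult_cancel_right mult_zero_right)
  then have "r1 = 2 * t" "r0 = u * t"
    using \<open>c = 0\<close> two by (auto simp: a_def c_def)
  then show ?thesis
    by (simp only: t_def)
qed

text \<open>Here \<open>h\<close> is u/U, so the remainder is a combination of x h and h. The first
  power sum removes the x h part, and the cubes fix the other coefficient; q > 4 is exactly 3 < q -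
  1.\<close>

lemma quadratic_perm_necessary_even:
  fixes u w r0 r1 :: "'a::{field,finite}"
  assumes pp: "primepow CARD('a)" and q: "CARD('a) > 4" and two: "(2::'a) = 0"
    and nr: "\<And>x. x\<^sup>2 + u * x + w \<noteq> 0"
    and nz: "r1 \<noteq> 0 \<or> r0 \<noteq> 0"
    and bij: "bij (\<lambda>x. x + (r1 * x + r0) / (x\<^sup>2 + u * x + w))"
  shows "r1 = 2 * (4 * w - u\<^sup>2) \<and> r0 = u * (4 * w - u\<^sup>2)"
proof -
  let ?U = "\<lambda>x. x\<^sup>2 + u * x + w"
  define t where "t = u\<^sup>2"
  have three: "(3::'a) = 1"
  proof -
    have "(3::'a) = 2 + 1" by simp
    then show ?thesis unfolding two by simp
  qed
  have four: "(4::'a) = 0"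
  proof -
    have "(4::'a) = 2 * 2" by simp
    then show ?thesis unfolding two by simp
  qed
  have minus: "- x = x" for x :: 'a
    using double_char_2[OF two, of x] by (rule minus_unique)
  have t4: "4 * w - u\<^sup>2 = t"
    by (simp add: four t_def minus)
  have q3: "CARD('a) > 3"
    using q by simp
  obtain h where h': "\<And>x. ?U x * h x = 2 * x + u" and h0: "(\<Sum>x\<in>UNIV. h x) = 0"
    and h1': "(\<Sum>x\<in>UNIV. x * h x) = -1" and h2: "(\<Sum>x\<in>UNIV. x\<^sup>2 * h x) = u"
    using quadratic_log_deriv_sums[OF pp q3 nr] by blast
  have h: "?U x * h x = u" for x
    using h'[of x] by (simp only: two mult_zero_left add_0)
  have h1: "(\<Sum>x\<in>UNIV. x * h x) = 1"
    unfolding h1' by (rule minus)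
  have "u \<noteq> 0"
    by (rule quadratic_linear_coeff_nonzero_even[OF two nr])
  then have t: "t \<noteq> 0" by (simp add: t_def)
  have hU: "1 / ?U x = h x / u" for x
    using h[of x] nr[of x] \<open>u \<noteq> 0\<close> by (simp add: field_simps)
  have f: "x + (r1 * x + r0) / ?U x = x + (r1 / u) * (x * h x) + (r0 / u) * h x" for x
  proof -
    have "(r1 * x + r0) / ?U x = (r1 * x + r0) * (1 / ?U x)"
      by simp
    then show ?thesis
      unfolding hU by (simp add: add_divide_distrib algebra_simps)
  qed
  have "(\<Sum>x\<in>UNIV. (x + (r1 * x + r0) / ?U x) ^ 1) = 0"
    using q by (intro sum_power_bij[OF bij]) simp
  then have "r1 / u = 0"
    unfolding f using h0 h1 by (simp add: sum.distrib sum_id_eq_0[OF q3] flip: sum_distrib_left sum_divide_distrib)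
  then have "r1 = 0"
    using \<open>u \<noteq> 0\<close> by simp
  define X where "X = (\<Sum>x\<in>UNIV. x * (h x)\<^sup>2)"
  define Y where "Y = (\<Sum>x\<in>UNIV. (h x) ^ 3)"
  \<comment> \<open>This is U h = u multiplied by h. After summation the two squares become squares
    of the known moments 1 and 0, which leaves \<open>u * X = 1\<close>.\<close>
  have "(x * h x)\<^sup>2 + u * (x * (h x)\<^sup>2) + w * (h x)\<^sup>2 = u * h x" for x
  proof -
    have "(x * h x)\<^sup>2 + u * (x * (h x)\<^sup>2) + w * (h x)\<^sup>2 = (?U x * h x) * h x"
      by (simp add: power2_eq_square algebra_simps)
    then show ?thesis using h by simp
  qed
  then have "(\<Sum>x\<in>UNIV. (x * h x)\<^sup>2 + u * (x * (h x)\<^sup>2) + w * (h x)\<^sup>2) = (\<Sum>x\<in>UNIV. u * h x)"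
    by simp
  then have X: "u * X = 1"
    using h0 h1
    by (simp add: sum.distrib sum_square_char_2[OF two] X_def minus add_eq_0_iff flip: sum_distrib_left)
  have cube_sum: "b * u + b\<^sup>2 * X + b ^ 3 * Y = 0" if "bij (\<lambda>x. x + b * h x)" for b
  proof -
    have "(\<Sum>x\<in>UNIV. (x + b * h x) ^ 3) = 0" "(\<Sum>x\<in>UNIV. x ^ 3) = (0::'a)"
      using q by (intro sum_power_bij[OF that] sum_power_less_card; simp)+
    moreover have "(x + b * h x) ^ 3 =
        x ^ 3 + 3 * b * (x\<^sup>2 * h x) + 3 * b\<^sup>2 * (x * (h x)\<^sup>2) + b ^ 3 * (h x) ^ 3" for x
      by (simp add: power2_eq_square power3_eq_cube algebra_simps)
    ultimately show ?thesis
      using h2 by (simp add: sum.distrib three X_def Y_def flip: sum_distrib_left)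
  qed
  define a where "a = r0 / u"
  have "bij (\<lambda>x. x + a * h x)"
    using bij unfolding f a_def by (simp add: \<open>r1 = 0\<close>)
  from cube_sum[OF this] have "a * (u + a * X + a\<^sup>2 * Y) = 0"
    by (simp add: algebra_simps power2_eq_square power3_eq_cube)
  moreover have "a \<noteq> 0"
    using nz \<open>r1 = 0\<close> \<open>u \<noteq> 0\<close> by (auto simp: a_def)
  ultimately have A: "u + a * X + a\<^sup>2 * Y = 0"
    by simp
  have "x + t * (2 * x + u) / ?U x = x + (t * u) * (1 / ?U x)" for x
    by (simp add: two)
  then have "bij (\<lambda>x. x + t * h x)"
    using quadratic_perm_sufficient[OF nr] \<open>u \<noteq> 0\<close> unfolding t4 hU by simp
  from cube_sum[OF this] have "t * (u + t * X + t\<^sup>2 * Y) = 0"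
    by (simp add: algebra_simps power2_eq_square power3_eq_cube)
  then have "u + t * X + t\<^sup>2 * Y = 0"
    using t by simp
  \<comment> \<open>The known permutation with b = t yields u + u = 0 in its cube relation, which
    forces \<open>Y = 0\<close>; the relation for a is then linear.\<close>
  moreover have "t * X = u"
    using X by (simp add: t_def power2_eq_square mult.assoc)
  ultimately have "Y = 0"
    using t double_char_2[OF two, of u] by simp
  then have "u * (u + a * X) = 0"
    using A by simp
  moreover have "u * (u + a * X) = u\<^sup>2 + a * (u * X)"
    by (simp add: algebra_simps power2_eq_square)
  ultimately have "u\<^sup>2 + a = 0"
    using X by simp
  then have "a = t"
    by (simp add: t_def add_eq_0_iff minus)
  then show ?thesis
    using \<open>r1 = 0\<close> \<open>u \<noteq> 0\<close> two unfolding t4 by (auto simp: a_def field_simps)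
qed

lemma quadratic_perm_iff:
  fixes u w r0 r1 :: "'a::{field,finite}"
  assumes "primepow CARD('a)" and "CARD('a) > 4"
    and nr: "\<And>x. x\<^sup>2 + u * x + w \<noteq> 0"
    and nz: "r1 \<noteq> 0 \<or> r0 \<noteq> 0"
  shows "bij (\<lambda>x. x + (r1 * x + r0) / (x\<^sup>2 + u * x + w)) \<longleftrightarrow>
    r1 = 2 * (4 * w - u\<^sup>2) \<and> r0 = u * (4 * w - u\<^sup>2)"
proof
  assume "bij (\<lambda>x. x + (r1 * x + r0) / (x\<^sup>2 + u * x + w))"
  then show "r1 = 2 * (4 * w - u\<^sup>2) \<and> r0 = u * (4 * w - u\<^sup>2)"
    using assms quadratic_perm_necessary_odd[of u w r1 r0] quadratic_perm_necessary_even[of u w r1 r0]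
    by (cases "(2::'a) = 0") auto
next
  define t where "t = 4 * w - u\<^sup>2"
  assume "r1 = 2 * (4 * w - u\<^sup>2) \<and> r0 = u * (4 * w - u\<^sup>2)"
  then have "r1 * x + r0 = (4 * w - u\<^sup>2) * (2 * x + u)" for x
    unfolding t_def[symmetric] by (simp add: algebra_simps)
  then show "bij (\<lambda>x. x + (r1 * x + r0) / (x\<^sup>2 + u * x + w))"
    using quadratic_perm_sufficient[OF nr] by simp
qed

text \<open>The remainder forced by the permutation property is nonzero, hence the fraction built
  from it is in lowest terms.\<close>

lemma quadratic_numerator_nonzero:
  fixes u w :: "'a::{field,finite}"
  assumes nr: "\<And>x. x\<^sup>2 + u * x + w \<noteq> 0"
  shows "2 * (4 * w - u\<^sup>2) \<noteq> 0 \<or> u * (4 * w - u\<^sup>2) \<noteq> 0"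
proof (cases "(2::'a) = 0")
  case False
  then show ?thesis
    using quadratic_disc_nonzero_odd[OF False nr] by (metis mult_eq_0_iff)
next
  case True
  have "(4::'a) = 2 * 2"
    by simp
  then have "(4::'a) = 0"
    unfolding True by simp
  then show ?thesis
    using True quadratic_linear_coeff_nonzero_even[OF True nr] by simp
qed

section \<open>Polynomials of degree two and three\<close>

lemma bij_plus_const_iff: "bij (\<lambda>x. g x + c) \<longleftrightarrow> bij g"
  for c :: "'a::group_add"
proof
  have "bij (\<lambda>y. y + c)" "bij (\<lambda>y. y - c)"
    by (rule bij_betw_byWitness[of _ "\<lambda>y. y - c"]; simp)
      (rule bij_betw_byWitness[of _ "\<lambda>y. y + c"]; simp)
  note shift = this
  show "bij g" if "bij (\<lambda>x. g x + c)"
    using bij_comp[OF that shift(2)] by (simp add: o_def)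
  show "bij (\<lambda>x. g x + c)" if "bij g"
    using bij_comp[OF that shift(1)] by (simp add: o_def)
qed

lemma bij_shift_iff: "bij (\<lambda>x. f (x - c)) \<longleftrightarrow> bij f"
  for c :: "'a::group_add"
proof
  have "bij (\<lambda>y. y + c)" "bij (\<lambda>y. y - c)"
    by (rule bij_betw_byWitness[of _ "\<lambda>y. y - c"]; simp)
      (rule bij_betw_byWitness[of _ "\<lambda>y. y + c"]; simp)
  note shift = this
  show "bij f" if "bij (\<lambda>x. f (x - c))"
    using bij_comp[OF shift(1) that] by (simp add: o_def)
  show "bij (\<lambda>x. f (x - c))" if "bij f"
    using bij_comp[OF shift(2) that] by (simp add: o_def)
qed

lemma bij_finite_iff_inj: "bij f \<longleftrightarrow> inj f" for f :: "'a::finite \<Rightarrow> 'a"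
  by (auto simp: bij_def finite_UNIV_inj_surj)

text \<open>x^2 + a x vanishes at both 0 and -a; once a = 0, the points 1 and -1 collide unless 2 =
  0.\<close>

lemma quadratic_poly_perm_iff:
  fixes a c :: "'a::{field,finite}"
  shows "bij (\<lambda>x. x\<^sup>2 + a * x + c) \<longleftrightarrow> (2::'a) = 0 \<and> a = 0"
proof
  assume "bij (\<lambda>x. x\<^sup>2 + a * x + c)"
  then have "inj (\<lambda>x. x\<^sup>2 + a * x)"
    unfolding bij_plus_const_iff by (rule bij_is_inj)
  then have inj: "x = y" if "x\<^sup>2 + a * x = y\<^sup>2 + a * y" for x y
    using that by (rule injD)
  have "- a = 0"
    by (rule inj) (simp add: power2_eq_square)
  then have "a = 0" by simp
  have "1 = (-1::'a)"
    by (rule inj) (simp add: \<open>a = 0\<close>)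
  then have "1 + 1 = (0::'a)"
    unfolding eq_neg_iff_add_eq_0 .
  with \<open>a = 0\<close> show "(2::'a) = 0 \<and> a = 0"
    by simp
next
  assume "(2::'a) = 0 \<and> a = 0"
  then show "bij (\<lambda>x. x\<^sup>2 + a * x + c)"
    unfolding bij_plus_const_iff by (simp add: square_bij_char_2)
qed

text \<open>These are the coefficients of X^(q-1) needed for Hermite's criterion: the first for q =
  3k + 1, the second for q = 3k + 2. The second arises by choosing b X from one of the k + 1 factors
  and X^3 from the others.\<close>

lemma coeff_depressed_cubic_power:
  fixes b :: "'a::comm_ring_1"
  shows "coeff ([:0, b, 0, 1:] ^ k) (3 * k) = 1"
    and "coeff ([:0, b, 0, 1:] ^ Suc k) (3 * k + 1) = of_nat (Suc k) * b"
proof -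
  have rec: "coeff ([:0, b, 0, 1:] * p) (n + 3) = b * coeff p (n + 2) + coeff p n" for p n
    by (simp add: coeff_pCons eval_nat_numeral split: nat.splits)
  have deg: "degree ([:0, b, 0, 1:] ^ k) \<le> 3 * k" for k
    using degree_power_le[of "[:0, b, 0, 1:]" k] by simp
  show top: "coeff ([:0, b, 0, 1:] ^ k) (3 * k) = 1" for k
  proof (induction k)
    case (Suc k)
    have "coeff ([:0, b, 0, 1:] ^ k) (3 * k + 2) = 0"
      using deg[of k] by (intro coeff_eq_0) linarith
    then show ?case
      using rec[of "[:0, b, 0, 1:] ^ k" "3 * k"] Suc by (simp add: add.commute)
  qed simp
  show "coeff ([:0, b, 0, 1:] ^ Suc k) (3 * k + 1) = of_nat (Suc k) * b"
  proof (induction k)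
    case (Suc k)
    have idx: "3 * Suc k + 1 = (3 * k + 1) + 3" "(3 * k + 1) + 2 = 3 * Suc k"
      by simp_all
    have "coeff ([:0, b, 0, 1:] ^ Suc (Suc k)) (3 * Suc k + 1) =
        b * coeff ([:0, b, 0, 1:] ^ Suc k) (3 * Suc k) + coeff ([:0, b, 0, 1:] ^ Suc k) (3 * k + 1)"
      by (simp only: power_Suc[of _ "Suc k"] idx(1) rec[of _ "3 * k + 1"] idx(2))
    then show ?case
      by (simp only: top Suc) (simp add: algebra_simps)
  qed simp
qed

lemma depressed_cubic_perm_imp:
  fixes b :: "'a::{field,finite}"
  assumes pp: "primepow CARD('a)" and q: "CARD('a) > 3" and three: "(3::'a) \<noteq> 0"
    and bij: "bij (\<lambda>x. x ^ 3 + b * x)"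
  shows "CARD('a) mod 3 = 2 \<and> b = 0"
proof -
  have poly: "poly ([:0, b, 0, 1:] ^ k) x = (x ^ 3 + b * x) ^ k" for k x
    by (simp add: algebra_simps power3_eq_cube)
  have deg: "degree ([:0, b, 0, 1:] ^ k) \<le> 3 * k" for k
    using degree_power_le[of "[:0, b, 0, 1:]" k] by simp
  have zero: "coeff ([:0, b, 0, 1:] ^ k) (CARD('a) - 1) = 0"
    if "3 * k \<le> CARD('a) + 1" for k
  proof -
    have "(\<Sum>x\<in>UNIV. poly ([:0, b, 0, 1:] ^ k) x) = 0"
      unfolding poly using that q by (intro sum_power_bij[OF bij]) linarith
    then show ?thesis
      using deg[of k] that q by (subst (asm) sum_poly_eq_coeff) auto
  qed
  have "CARD('a) mod 3 \<noteq> 0"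
    using three three_eq_0_iff[OF pp] by simp
  then consider "CARD('a) mod 3 = 1" | "CARD('a) mod 3 = 2"
    by linarith
  then show ?thesis
  proof cases
    case 1
    then obtain k where k: "CARD('a) = 3 * k + 1"
      using mult_div_mod_eq[of 3 "CARD('a)"] by metis
    then have "(1::'a) = 0"
      using zero[of k] coeff_depressed_cubic_power(1)[of b k] by simp
    then show ?thesis by simp
  next
    case 2
    then obtain k where k: "CARD('a) = 3 * k + 2"
      using mult_div_mod_eq[of 3 "CARD('a)"] by metis
    have "of_nat (Suc k) * b = 0"
      using zero[of "Suc k"] coeff_depressed_cubic_power(2)[of b k] k by simp
    \<comment> \<open>3 (k + 1) = q + 1 is 1 in the field, so k + 1 is invertible and b = 0
      follows.\<close>
    moreover have "of_nat (3 * Suc k) = (of_nat (CARD('a) + 1) :: 'a)"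
      using k by simp
    then have "3 * of_nat (Suc k) = (1::'a)"
      by (simp only: of_nat_mult of_nat_add of_nat_card_eq_0) simp
    then have "of_nat (Suc k) \<noteq> (0::'a)"
      by (metis mult_zero_right zero_neq_one)
    ultimately show ?thesis
      using 2 by simp
  qed
qed

lemma cube_bij:
  assumes "CARD('a::{field,finite}) mod 3 = 2"
  shows "bij (\<lambda>x::'a. x ^ 3)"
proof -
  define k where "k = CARD('a) div 3"
  have k: "CARD('a) = 3 * k + 2"
    using assms unfolding k_def by presburger
  \<comment> \<open>2k + 1 inverts 3 modulo q - 1: 3 (2k + 1) = q + (q - 1).\<close>
  have "(x ^ 3) ^ (2 * k + 1) = x" for x :: 'a
  proof (cases "x = 0")
    case False
    have "(x ^ 3) ^ (2 * k + 1) = x ^ CARD('a) * x ^ (CARD('a) - 1)"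
      unfolding k power_mult[symmetric] power_add[symmetric]
      by (rule arg_cong[of _ _ "power x"]) simp
    then show ?thesis
      by (simp only: power_card_eq_self power_card_minus_1[OF False] mult_1_right)
  qed simp
  then have "inj (\<lambda>x::'a. x ^ 3)"
    by (metis injI)
  then show ?thesis
    by (simp add: bij_finite_iff_inj)
qed

lemma cubic_perm_iff:
  fixes a b c :: "'a::{field,finite}"
  assumes pp: "primepow CARD('a)" and q: "CARD('a) > 3" and three: "(3::'a) \<noteq> 0"
  shows "bij (\<lambda>x. x ^ 3 + a * x\<^sup>2 + b * x + c) \<longleftrightarrow> CARD('a) mod 3 = 2 \<and> 3 * b = a\<^sup>2"
proof -
  \<comment> \<open>The shift x = y - s removes the quadratic term; the new linear coefficient
    \<open>b'\<close> vanishes iff 3 b = a^2.\<close>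
  define s where "s = a / 3"
  define b' where "b' = b - 3 * s\<^sup>2"
  define c' where "c' = 2 * s ^ 3 - b * s + c"
  have a: "a = 3 * s"
    using three by (simp add: s_def)
  have "(y - s) ^ 3 + a * (y - s)\<^sup>2 + b * (y - s) + c = y ^ 3 + b' * y + c'" for y
    unfolding a b'_def c'_def by (simp add: power2_eq_square power3_eq_cube algebra_simps)
  then have "bij (\<lambda>x. x ^ 3 + a * x\<^sup>2 + b * x + c) \<longleftrightarrow> bij (\<lambda>y. y ^ 3 + b' * y + c')"
    using bij_shift_iff[of "\<lambda>x. x ^ 3 + a * x\<^sup>2 + b * x + c" s] by (simp only:)
  also have "\<dots> \<longleftrightarrow> bij (\<lambda>y. y ^ 3 + b' * y)"
    by (rule bij_plus_const_iff)
  also have "\<dots> \<longleftrightarrow> CARD('a) mod 3 = 2 \<and> b' = 0"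
    using depressed_cubic_perm_imp[OF pp q three, of b'] cube_bij[where 'a='a] by auto
  also have "b' = 0 \<longleftrightarrow> 3 * b' = 0"
    using three by simp
  also have "3 * b' = 3 * b - a\<^sup>2"
    unfolding a b'_def by (simp add: power2_eq_square algebra_simps)
  finally show ?thesis
    by simp
qed

text \<open>For a = 0 the map x^3 + b x is additive in characteristic 3, so it is injective iff its
  kernel is trivial, i.e. iff no nonzero x has x^2 = -b.\<close>

lemma cubic_perm_iff_char_3:
  fixes a b c :: "'a::{field,finite}"
  assumes three: "(3::'a) = 0"
  shows "bij (\<lambda>x. x ^ 3 + a * x\<^sup>2 + b * x + c) \<longleftrightarrow> a = 0 \<and> - b \<notin> (\<lambda>x. x\<^sup>2) ` (UNIV - {0})"
proof
  assume "bij (\<lambda>x. x ^ 3 + a * x\<^sup>2 + b * x + c)"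
  then have "inj (\<lambda>x. x ^ 3 + a * x\<^sup>2 + b * x)"
    unfolding bij_plus_const_iff by (rule bij_is_inj)
  then have inj: "x = y" if "x ^ 3 + a * x\<^sup>2 + b * x = y ^ 3 + a * y\<^sup>2 + b * y" for x y
    using that by (rule injD)
  have "a = 0"
  proof (rule ccontr)
    assume "a \<noteq> 0"
    define s where "s = - (1 + b) / a"
    have s: "a * s = - 1 - b"
      using \<open>a \<noteq> 0\<close> by (simp add: s_def)
    \<comment> \<open>With f the cubic map and 3 = 0, f(y + 1) - f(y) = 2 a y + a + b + 1 is linear
      in y, and this y is its zero.\<close>
    define x y where "x = - s - 1" and "y = - s - 2"
    have "(x ^ 3 + a * x\<^sup>2 + b * x) - (y ^ 3 + a * y\<^sup>2 + b * y)
        = 1 + a * s + b + 3 * (s\<^sup>2 + 3 * s + 2 - a * s - a)"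
      unfolding x_def y_def by (simp add: power2_eq_square power3_eq_cube algebra_simps)
    also have "\<dots> = 1 + (- 1 - b) + b + 0"
      by (simp only: three s mult_zero_left)
    also have "\<dots> = 0"
      by simp
    finally have "x = y"
      by - (rule inj, simp only: right_minus_eq)
    moreover have "x - y = 1"
      by (simp add: x_def y_def)
    ultimately show False
      by simp
  qed
  moreover have "- b \<noteq> x\<^sup>2" if "x \<noteq> 0" for x
  proof
    assume "- b = x\<^sup>2"
    then have "b = - x\<^sup>2" by (metis minus_minus)
    then have "x = 0"
      by - (rule inj, simp add: \<open>a = 0\<close> power3_eq_cube power2_eq_square)
    with that show False by simp
  qed
  ultimately show "a = 0 \<and> - b \<notin> (\<lambda>x. x\<^sup>2) ` (UNIV - {0})"
    by auto
next
  assume *: "a = 0 \<and> - b \<notin> (\<lambda>x. x\<^sup>2) ` (UNIV - {0})"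
  have "x = y" if "x ^ 3 + b * x = y ^ 3 + b * y" for x y
  proof (rule ccontr)
    assume "x \<noteq> y"
    have "(x - y) * (b + (x - y)\<^sup>2) = (x ^ 3 + b * x) - (y ^ 3 + b * y) - 3 * (x\<^sup>2 * y - x * y\<^sup>2)"
      by (simp add: power2_eq_square power3_eq_cube algebra_simps)
    also have "\<dots> = 0"
      by (simp only: that three mult_zero_left) simp
    finally have "b + (x - y)\<^sup>2 = 0"
      using \<open>x \<noteq> y\<close> by simp
    then have "- b = (x - y)\<^sup>2"
      by (rule minus_unique)
    then show False
      using * \<open>x \<noteq> y\<close> by auto
  qed
  then have "bij (\<lambda>x. x ^ 3 + b * x)"
    unfolding bij_finite_iff_inj by (auto intro: injI)
  then have "bij (\<lambda>x. x ^ 3 + b * x + c)"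
    unfolding bij_plus_const_iff .
  then show "bij (\<lambda>x. x ^ 3 + a * x\<^sup>2 + b * x + c)"
    using * by simp
qed

section \<open>Counting parameters\<close>

lemma card_two_to_one:
  assumes "finite X" and "\<And>x. x \<in> X \<Longrightarrow> card {z \<in> X. g z = g x} = 2"
  shows "card X = 2 * card (g ` X)"
proof -
  have "card X = (\<Sum>y\<in>g ` X. card {z \<in> X. g z = y})"
    using sum.image_gen[OF assms(1), of "\<lambda>_. 1::nat" g] by simp
  also have "\<dots> = (\<Sum>y\<in>g ` X. 2)"
    using assms(2) by (intro sum.cong) auto
  finally show ?thesis by simp
qed

lemma card_nonzero_squares:
  assumes two: "(2::'a::{field,finite}) \<noteq> 0"
  shows "2 * card ((\<lambda>x::'a. x\<^sup>2) ` (UNIV - {0})) = CARD('a) - 1"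
proof -
  have "card {z \<in> UNIV - {0}. z\<^sup>2 = x\<^sup>2} = 2" if "x \<in> UNIV - {0}" for x :: 'a
  proof -
    have "x \<noteq> - x"
      using that two by (metis DiffD2 add_eq_0_iff insertI1 mult_2 mult_eq_0_iff)
    moreover have "{z \<in> UNIV - {0}. z\<^sup>2 = x\<^sup>2} = {x, - x}"
      using that by (auto simp: power2_eq_iff)
    ultimately show ?thesis by simp
  qed
  then have "card (UNIV - {0::'a}) = 2 * card ((\<lambda>x::'a. x\<^sup>2) ` (UNIV - {0}))"
    by (intro card_two_to_one) auto
  then show ?thesis
    by (simp add: card_Diff_singleton)
qed

definition rootless_quadratics :: "('a::field \<times> 'a) set" where
  "rootless_quadratics = {(u, w). \<forall>x. x\<^sup>2 + u * x + w \<noteq> 0}"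

text \<open>The complement consists of the products (X - a)(X - b), with \<open>g\<close> the Vieta
  map: q of them have a = b, and the q (q - 1) pairs with a \<noteq> b are identified in
  twos.\<close>

lemma card_rootless_quadratics:
  "2 * card (rootless_quadratics :: ('a::{field,finite} \<times> 'a) set) = CARD('a) * (CARD('a) - 1)"
proof -
  define g :: "'a \<times> 'a \<Rightarrow> 'a \<times> 'a" where "g = (\<lambda>(a, b). (- (a + b), a * b))"
  define D where "D = {(a, b). a = (b::'a)}"
  define X where "X = {(a, b). a \<noteq> (b::'a)}"
  have g: "x\<^sup>2 + fst (g p) * x + snd (g p) = (x - fst p) * (x - snd p)" for x p
    by (simp add: g_def split_beta power2_eq_square algebra_simps)
  have g_eq: "g p = g p' \<longleftrightarrow> p' = p \<or> p' = (snd p, fst p)" for p p'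
  proof
    assume eq: "g p = g p'"
    have "(fst p' - fst p) * (fst p' - snd p) = 0" "(snd p' - fst p) * (snd p' - snd p) = 0"
      unfolding g[symmetric] eq unfolding g by simp_all
    \<comment> \<open>The two products alone would allow both entries of \<open>p'\<close> to equal
      the same entry of \<open>p\<close>; the sum rules this out.\<close>
    moreover have "fst p + snd p = fst p' + snd p'"
      using arg_cong[OF eq, of fst] by (simp only: g_def split_beta fst_conv neg_equal_iff_equal)
    ultimately show "p' = p \<or> p' = (snd p, fst p)"
      by (auto simp: prod_eq_iff)
  qed (auto simp: g_def split_beta algebra_simps)
  have rootful: "UNIV - rootless_quadratics = g ` D \<union> g ` X"
  proof (intro equalityI subsetI)
    fix p :: "'a \<times> 'a" assume "p \<in> UNIV - rootless_quadratics"
    then obtain x where x: "x\<^sup>2 + fst p * x + snd p = 0"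
      by (auto simp: rootless_quadratics_def)
    then have snd: "snd p = - (x\<^sup>2 + fst p * x)"
      by (rule minus_unique[symmetric])
    have "p = g (x, - fst p - x)"
      by (simp add: g_def prod_eq_iff snd power2_eq_square algebra_simps)
    then show "p \<in> g ` D \<union> g ` X"
      by (auto simp: D_def X_def simp flip: image_Un)
  next
    fix p assume "p \<in> g ` D \<union> g ` X"
    then obtain r where "p = g r" by auto
    then show "p \<in> UNIV - rootless_quadratics"
      using g[of "fst r" r] by (auto simp: rootless_quadratics_def split_beta)
  qed
  have "g ` D \<inter> g ` X = {}"
    by (auto simp: D_def X_def g_eq)
  moreover have "card (g ` D) = CARD('a)"
  proof -
    have "inj_on g D"
      by (auto simp: inj_on_def g_eq D_def)
    moreover have "D = (\<lambda>a. (a, a)) ` UNIV"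
      by (auto simp: D_def)
    then have "card D = CARD('a)"
      by (simp add: card_image inj_on_def)
    ultimately show ?thesis
      by (simp add: card_image)
  qed
  moreover have "2 * card (g ` X) = CARD('a) * CARD('a) - CARD('a)"
  proof -
    have "{z \<in> X. g z = g p} = {p, (snd p, fst p)}" if "p \<in> X" for p
      using that by (auto simp: g_eq X_def)
    moreover have "p \<noteq> (snd p, fst p)" if "p \<in> X" for p
      using that by (auto simp: X_def prod_eq_iff)
    ultimately have "card X = 2 * card (g ` X)"
      by (intro card_two_to_one) auto
    moreover have "X = UNIV - D" and "D = (\<lambda>a. (a, a)) ` UNIV"
      by (auto simp: X_def D_def)
    then have "card X = CARD('a) * CARD('a) - CARD('a)"
      by (simp add: card_Diff_subset card_image inj_on_def)
    ultimately show ?thesis by simp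
  qed
  moreover have "card (rootless_quadratics :: ('a \<times> 'a) set) = CARD('a) * CARD('a) - card (g ` D \<union> g ` X)"
    using card_Diff_subset[of "UNIV - rootless_quadratics" "UNIV :: ('a \<times> 'a) set"]
    by (simp add: Diff_Diff_Int flip: rootful)
  ultimately have "2 * card (rootless_quadratics :: ('a \<times> 'a) set) =
      2 * (CARD('a) * CARD('a)) - (2 * CARD('a) + (CARD('a) * CARD('a) - CARD('a)))"
    by (simp add: card_Un_disjoint)
  moreover have "CARD('a) \<le> CARD('a) * CARD('a)"
    by simp
  ultimately show ?thesis
    by (simp add: right_diff_distrib')
qed

section \<open>Coprime polynomials and the fraction field\<close>

lemma poly_bezout:
  fixes p r :: "'a::field poly"
  assumes "coprime p r"
  shows "\<exists>s t. s * p + t * r = 1"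
  using assms
\<comment> \<open>Since \<open>degree 0 = 0\<close>, the measure must rank the zero remainder
  strictly below nonzero constants for Euclid's algorithm to terminate.\<close>
proof (induction "if r = 0 then 0 else Suc (degree r)" arbitrary: p r rule: less_induct)
  case less
  show ?case
  proof (cases "r = 0")
    case True
    then have "p dvd 1"
      using less.prems by simp
    then obtain s where "1 = p * s"
      by (rule dvdE)
    then have "s * p + 0 * r = 1"
      by (simp add: mult.commute)
    then show ?thesis by blast
  next
    case False
    have "coprime r (p mod r)"
      using less.prems False by (simp add: coprime_commute)
    moreover have "p mod r = 0 \<or> degree (p mod r) < degree r"
      using degree_mod_less[OF False] .
    then have "(if p mod r = 0 then 0 else Suc (degree (p mod r))) <
        (if r = 0 then 0 else Suc (degree r))"
      using False by auto
    ultimately obtain s t where "s * r + t * (p mod r) = 1"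
      using less.hyps by blast
    then have "s * r + t * (p - p div r * r) = 1"
      by (simp only: minus_div_mult_eq_mod)
    then have "t * p + (s - t * (p div r)) * r = 1"
      by (simp add: algebra_simps)
    then show ?thesis by blast
  qed
qed

lemma coprime_poly_dvd_mult:
  fixes p r :: "'a::field poly"
  assumes "coprime p r" and "r dvd p * z"
  shows "r dvd z"
proof -
  obtain s t where "s * p + t * r = 1"
    using poly_bezout[OF assms(1)] by blast
  then have "z = s * (p * z) + t * z * r"
    by (metis (no_types, lifting) distrib_right mult.assoc mult.commute mult_1)
  then show ?thesis
    using assms(2) by (metis dvd_add dvd_mult dvd_triv_right)
qed

lemma monic_dvd_antisym:
  fixes p r :: "'a::field poly"
  assumes "p dvd r" "r dvd p" "lead_coeff p = 1" "lead_coeff r = 1"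
  shows "p = r"
proof -
  obtain s where s: "r = p * s"
    using assms(1) by (rule dvdE)
  have "p \<noteq> 0" "r \<noteq> 0"
    using assms by auto
  then have "s \<noteq> 0"
    using s by auto
  have "degree r \<le> degree p"
    using assms(2) \<open>p \<noteq> 0\<close> by (rule dvd_imp_degree_le)
  then have "degree s = 0"
    using s degree_mult_eq[OF \<open>p \<noteq> 0\<close> \<open>s \<noteq> 0\<close>] by simp
  moreover have "lead_coeff s = 1"
    using assms s by (simp add: lead_coeff_mult)
  ultimately have "s = 1"
    by (metis degree_0_id one_pCons of_nat_1 lead_coeff_pCons(2) degree_eq_zeroE pCons_0_0 coeff_pCons_0)
  then show ?thesis
    using s by simp
qed

text \<open>Serves twice: it makes the pair representing a fraction unique, and it shows that the
  cross product of two different fractions is nonzero.\<close>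

lemma coprime_monic_cross_eq:
  fixes V U V' U' :: "'a::field poly"
  assumes "coprime V U" "coprime V' U'" "lead_coeff U = 1" "lead_coeff U' = 1"
    and cross: "V * U' = V' * U"
  shows "V = V' \<and> U = U'"
proof -
  have "U dvd V * U'" "U' dvd V' * U"
    unfolding cross by (simp, simp flip: cross)
  then have "U dvd U'" "U' dvd U"
    using assms coprime_poly_dvd_mult by blast+
  then have "U = U'"
    using assms by (intro monic_dvd_antisym)
  moreover have "U \<noteq> 0"
    using assms by auto
  ultimately show ?thesis
    using cross by simp
qed

lemma ratfun_eval_smult_both:
  assumes "c \<noteq> 0"
  shows "ratfun_eval (smult c V) (smult c U) = ratfun_eval V U"
proof
  fix x show "ratfun_eval (smult c V) (smult c U) x = ratfun_eval V U x"
    using assms by (cases x) auto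
qed

text \<open>A monic denominator selects one pair from each class under common scaling, so elements
  of the fraction field can be counted as pairs of polynomials.\<close>

definition reduced_prfs :: "('a::{field,finite} poly \<times> 'a poly) set" where
  "reduced_prfs = {(V, U). V \<noteq> 0 \<and> lead_coeff U = 1 \<and> coprime V U \<and>
     degree V \<le> 3 \<and> degree U \<le> 3 \<and> bij (ratfun_eval V U)}"

lemma finite_reduced_prfs: "finite (reduced_prfs :: ('a::{field,finite} poly \<times> 'a poly) set)"
proof -
  have "p \<in> (\<lambda>(a, b, c, d). [:a, b, c, d:]) ` UNIV" if "degree p \<le> 3" for p :: "'a poly"
  proof -
    have "p = [:coeff p 0, coeff p 1, coeff p 2, coeff p 3:]"
      using that by (intro poly_eqI) (auto simp: coeff_pCons eval_nat_numeral coeff_eq_0 split: nat.splits)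
    then show ?thesis by (auto intro!: image_eqI[where x = "(coeff p 0, coeff p 1, coeff p 2, coeff p 3)"])
  qed
  then have "{p :: 'a poly. degree p \<le> 3} \<subseteq> (\<lambda>(a, b, c, d). [:a, b, c, d:]) ` UNIV"
    by blast
  then have "finite {p :: 'a poly. degree p \<le> 3}"
    by (rule finite_subset) simp
  then have "finite ({p :: 'a poly. degree p \<le> 3} \<times> {p :: 'a poly. degree p \<le> 3})"
    by simp
  then show ?thesis
    by (rule rev_finite_subset) (auto simp: reduced_prfs_def)
qed

lemma inj_on_Fract_reduced_prfs: "inj_on (\<lambda>(V, U). Fract V U) reduced_prfs"
proof (rule inj_onI, clarify)
  fix V U V' U' :: "'a poly"
  assume VU: "(V, U) \<in> reduced_prfs" "(V', U') \<in> reduced_prfs" and eq: "Fract V U = Fract V' U'"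
  then have "U \<noteq> 0" "U' \<noteq> 0"
    by (auto simp: reduced_prfs_def)
  with eq have "V * U' = V' * U"
    by (simp add: eq_fract)
  then show "V = V' \<and> U = U'"
    using VU by (intro coprime_monic_cross_eq) (auto simp: reduced_prfs_def)
qed

lemma PRF_eq_image:
  assumes "v \<le> 3" "u \<le> 3"
  shows "(PRF v u :: 'a::{field,finite} poly fract set) = (\<lambda>(V, U). Fract V U) ` {p \<in> reduced_prfs. (degree (fst p), degree (snd p)) = (v, u)}"
    (is "_ = ?f ` ?S")
proof (intro equalityI subsetI)
  fix z :: "'a poly fract" assume "z \<in> PRF v u"
  then obtain V U where VU: "z = Fract V U" "V \<noteq> 0" "U \<noteq> 0" "coprime V U" "degree V = v" "degree U = u"
    "bij (ratfun_eval V U)"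
    by (auto simp: PRF_def)
  define c where "c = inverse (lead_coeff U)"
  have "c \<noteq> 0"
    using VU(3) by (simp add: c_def)
  have "coprime (smult c V) (smult c U)"
    using VU(4) \<open>c \<noteq> 0\<close> by (auto simp: coprime_def dvd_smult_iff)
  then have "(smult c V, smult c U) \<in> ?S"
    using VU assms \<open>c \<noteq> 0\<close> ratfun_eval_smult_both[OF \<open>c \<noteq> 0\<close>, of V U]
    by (simp add: reduced_prfs_def c_def)
  moreover have "z = ?f (smult c V, smult c U)"
    using VU \<open>c \<noteq> 0\<close> by (simp add: eq_fract)
  ultimately show "z \<in> ?f ` ?S"
    by blast
next
  fix z :: "'a poly fract" assume "z \<in> ?f ` ?S"
  then obtain V U where "z = Fract V U" "(V, U) \<in> reduced_prfs" "degree V = v" "degree U = u"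
    by auto
  moreover from this have "U \<noteq> 0"
    by (auto simp: reduced_prfs_def)
  ultimately show "z \<in> PRF v u"
    by (auto simp: PRF_def reduced_prfs_def)
qed

lemma T5_eq_card: "T5 TYPE('a::{field,finite}) = card (reduced_prfs :: ('a poly \<times> 'a poly) set)"
proof -
  let ?R = "reduced_prfs :: ('a poly \<times> 'a poly) set"
  let ?g = "\<lambda>p :: 'a poly \<times> 'a poly. (degree (fst p), degree (snd p))"
  have "N_prf TYPE('a) v u = card {p \<in> ?R. ?g p = (v, u)}" if "v \<le> 3" "u \<le> 3" for v u
    unfolding N_prf_def PRF_eq_image[OF that]
    by (intro card_image inj_on_subset[OF inj_on_Fract_reduced_prfs]) auto
  then have "T5 TYPE('a) = (\<Sum>y\<in>{0..3} \<times> {0..3}. card {p \<in> ?R. ?g p = y})"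
    unfolding T5_def by (intro sum.cong) auto
  also have "\<dots> = (\<Sum>y\<in>{0..3} \<times> {0..3}. \<Sum>p\<in>{p \<in> ?R. ?g p = y}. 1)"
    by simp
  also have "\<dots> = (\<Sum>p\<in>?R. 1)"
    using finite_reduced_prfs by (intro sum.group[where g = ?g]) (auto simp: reduced_prfs_def)
  finally show ?thesis by simp
qed

section \<open>Normalising the value at infinity\<close>

text \<open>\<open>degree U < degree V\<close> expresses that infinity is fixed.\<close>

definition monic_prfs :: "('a::{field,finite} poly \<times> 'a poly) set" where
  "monic_prfs = {(V, U). lead_coeff V = 1 \<and> lead_coeff U = 1 \<and> coprime V U \<and>
     degree U < degree V \<and> degree V \<le> 3 \<and> bij (ratfun_eval V U)}"

lemma finite_monic_prfs: "finite (monic_prfs :: ('a::{field,finite} poly \<times> 'a poly) set)"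
  by (rule finite_subset[OF _ finite_reduced_prfs])
    (auto simp: monic_prfs_def reduced_prfs_def)

lemma bij_comp_left_iff:
  assumes "bij f"
  shows "bij (f \<circ> g) \<longleftrightarrow> bij g"
proof
  assume "bij (f \<circ> g)"
  then have "bij (inv f \<circ> (f \<circ> g))"
    using assms bij_comp bij_imp_bij_inv by blast
  then show "bij g"
    using assms by (simp add: bij_is_inj flip: comp_assoc)
qed (use assms bij_comp in blast)

lemma bij_ratfun_eval_smult_left:
  fixes V U :: "'a::field poly"
  assumes c: "c \<noteq> 0"
  shows "bij (ratfun_eval (smult c V) U) \<longleftrightarrow> bij (ratfun_eval V U)"
proof -
  have "map_option ((*) (inverse c)) (map_option ((*) c) y) = y"
    "map_option ((*) c) (map_option ((*) (inverse c)) y) = y" for y :: "'a option"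
    using c by (auto simp: option.map_comp o_def option.map_ident mult.assoc[symmetric])
  then have "bij (map_option ((*) c))"
    by (intro bij_betw_byWitness[of _ "map_option ((*) (inverse c))"]) auto
  moreover have "ratfun_eval (smult c V) U = map_option ((*) c) \<circ> ratfun_eval V U"
  proof
    fix x show "ratfun_eval (smult c V) U x = (map_option ((*) c) \<circ> ratfun_eval V U) x"
      using c by (cases x) auto
  qed
  ultimately show ?thesis
    by (simp add: bij_comp_left_iff)
qed

text \<open>For e \<noteq> 0 these are the Moebius transformations that send infinity to the finite
  point a. Applied after a function fixing infinity they produce the finite values there.\<close>

fun inversion_map :: "'a::field \<Rightarrow> 'a \<Rightarrow> 'a option \<Rightarrow> 'a option" where
  "inversion_map a e None = Some a"
| "inversion_map a e (Some y) = (if y = 0 then None else Some (a + e / y))"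

lemma bij_inversion_map:
  fixes a e :: "'a::field"
  assumes "e \<noteq> 0"
  shows "bij (inversion_map a e)"
proof -
  define g where "g = (\<lambda>z. case z of None \<Rightarrow> Some 0 | Some z \<Rightarrow> if z = a then None else Some (e / (z - a)))"
  have "g (inversion_map a e y) = y" for y
    using assms by (cases y) (auto simp: g_def)
  moreover have "inversion_map a e (g z) = z" for z
    using assms by (cases z) (auto simp: g_def)
  ultimately show ?thesis
    by (intro bij_betw_byWitness[of _ g]) auto
qed

lemma ratfun_eval_inversion:
  fixes V U :: "'a::field poly"
  assumes "coprime V U" "degree U < degree V"
  shows "ratfun_eval (smult a V + smult e U) V = inversion_map a e \<circ> ratfun_eval V U"
proof
  fix x show "ratfun_eval (smult a V + smult e U) V x = (inversion_map a e \<circ> ratfun_eval V U) x"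
  proof (cases x)
    case None
    have small: "degree (smult e U) < degree V"
      using assms(2) degree_smult_le[of e U] by linarith
    show ?thesis
    proof (cases "a = 0")
      case True
      then show ?thesis
        using None small assms(2) by simp
    next
      case False
      then have "degree (smult a V + smult e U) = degree V"
        using small by (subst degree_add_eq_left) auto
      moreover have "coeff U (degree V) = 0"
        using assms(2) by (rule coeff_eq_0)
      moreover have "V \<noteq> 0"
        using assms(2) by auto
      ultimately show ?thesis
        using None assms(2) by simp
    qed
  next
    case (Some y)
    \<comment> \<open>A common zero of V and U would break the equation, with infinity on the left
      and a on the right.\<close>
    obtain s t where "s * V + t * U = 1"
      using poly_bezout[OF assms(1)] by blast
    then have "poly (s * V + t * U) y = 1"
      by simp
    then have "poly V y \<noteq> 0 \<or> poly U y \<noteq> 0"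
      by auto
    then show ?thesis
      using Some by (auto simp: add_divide_distrib)
  qed
qed

lemma bij_ratfun_eval_inversion:
  fixes V U :: "'a::field poly"
  assumes "coprime V U" "degree U < degree V" "e \<noteq> 0"
  shows "bij (ratfun_eval (smult a V + smult e U) V) \<longleftrightarrow> bij (ratfun_eval V U)"
  using assms by (simp add: ratfun_eval_inversion bij_comp_left_iff bij_inversion_map)

lemma coprime_inversion:
  fixes V U :: "'a::field poly"
  assumes "e \<noteq> 0"
  shows "coprime (smult a V + smult e U) V \<longleftrightarrow> coprime V U"
proof -
  have "d dvd smult a V + smult e U \<longleftrightarrow> d dvd U" if "d dvd V" for d
    using that assms by (simp add: dvd_add_right_iff dvd_smult dvd_smult_iff)
  then show ?thesis
    by (auto simp: coprime_def)
qed

lemma coprime_smult_left_iff: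
  fixes V U :: "'a::field poly"
  assumes "a \<noteq> 0"
  shows "coprime (smult a V) U \<longleftrightarrow> coprime V U"
  using assms by (simp add: coprime_def dvd_smult_iff)

text \<open>The factor is (q - 1) + q (q - 1), counting the scalings a f and the maps a + e/f.
  Comparing degrees separates the two families, and leading coefficients recover a and e.\<close>

lemma card_reduced_prfs:
  "card (reduced_prfs :: ('a::{field,finite} poly \<times> 'a poly) set) =
    (CARD('a)\<^sup>2 - 1) * card (monic_prfs :: ('a poly \<times> 'a poly) set)"
proof -
  let ?B = "monic_prfs :: ('a poly \<times> 'a poly) set"
  let ?R = "reduced_prfs :: ('a poly \<times> 'a poly) set"
  define f where "f = (\<lambda>(a :: 'a, V :: 'a poly, U :: 'a poly). (smult a V, U))"
  define g where "g = (\<lambda>(a :: 'a, e :: 'a, V :: 'a poly, U :: 'a poly). (smult a V + smult e U, V))"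
  define A1 where "A1 = f ` ((UNIV - {0}) \<times> ?B)"
  define A2 where "A2 = g ` (UNIV \<times> (UNIV - {0}) \<times> ?B)"
  have inj_f: "a = a' \<and> V = V' \<and> U = U'"
    if *: "(V, U) \<in> ?B" "(V', U') \<in> ?B" "a \<noteq> 0" "a' \<noteq> 0" "f (a, V, U) = f (a', V', U')"
    for a a' :: 'a and V U V' U' :: "'a poly"
  proof -
    have "smult a V = smult a' V'" "U = U'"
      using *(5) by (auto simp: f_def)
    moreover from this have "lead_coeff (smult a V) = lead_coeff (smult a' V')"
      by simp
    then have "a = a'"
      using * by (simp only: lead_coeff_smult) (simp add: monic_prfs_def)
    ultimately show ?thesis
      using * smult_cancel by metis
  qed
  have "inj_on f ((UNIV - {0}) \<times> ?B)"
  proof (rule inj_onI)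
    fix p p' assume *: "p \<in> (UNIV - {0}) \<times> ?B" "p' \<in> (UNIV - {0}) \<times> ?B" "f p = f p'"
    obtain a V U a' V' U' where "p = (a, V, U)" "p' = (a', V', U')"
      by (metis prod_cases3)
    then show "p = p'"
      using * inj_f[of V U V' U' a a'] by simp
  qed
  then have A1: "card A1 = (CARD('a) - 1) * card ?B"
    by (simp add: A1_def card_image card_cartesian_product card_Diff_singleton)
  have inj_g: "a = a' \<and> e = e' \<and> V = V' \<and> U = U'"
    if *: "(V, U) \<in> ?B" "(V', U') \<in> ?B" "e \<noteq> 0" "e' \<noteq> 0" "g (a, e, V, U) = g (a', e', V', U')"
    for a e a' e' :: 'a and V U V' U' :: "'a poly"
  proof -
    have eq: "smult a V + smult e U = smult a' V + smult e' U'" and "V = V'"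
      using *(5) by (auto simp: g_def)
    then have "coeff U (degree V) = 0" "coeff U' (degree V) = 0" "coeff V (degree V) = 1"
      using * by (auto simp: monic_prfs_def coeff_eq_0)
    moreover have "coeff (smult a V + smult e U) (degree V) = coeff (smult a' V + smult e' U') (degree V)"
      by (simp only: eq)
    ultimately have "a = a'"
      by simp
    with eq have eqU: "smult e U = smult e' U'"
      by simp
    then have "lead_coeff (smult e U) = lead_coeff (smult e' U')"
      by simp
    then have "e = e'"
      using * by (simp only: lead_coeff_smult) (simp add: monic_prfs_def)
    with eqU * \<open>a = a'\<close> \<open>V = V'\<close> show ?thesis
      using smult_cancel by metis
  qed
  have "inj_on g (UNIV \<times> (UNIV - {0}) \<times> ?B)"
  proof (rule inj_onI)
    fix p p' assume *: "p \<in> UNIV \<times> (UNIV - {0}) \<times> ?B" "p' \<in> UNIV \<times> (UNIV - {0}) \<times> ?B" "g p = g p'"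
    obtain a e V U a' e' V' U' where "p = (a, e, V, U)" "p' = (a', e', V', U')"
      by (metis prod_cases4)
    then show "p = p'"
      using * inj_g[of V U V' U' e e' a a'] by simp
  qed
  then have A2: "card A2 = CARD('a) * ((CARD('a) - 1) * card ?B)"
    by (simp add: A2_def card_image card_cartesian_product card_Diff_singleton)
  have deg2: "degree (smult a V + smult e U) \<le> degree V" if "degree U < degree V"
    for a e :: 'a and V U :: "'a poly"
    using that degree_smult_le[of a V] degree_smult_le[of e U] by (intro degree_add_le) auto
  have disj: "A1 \<inter> A2 = {}"
  proof -
    have "degree (snd p) < degree (fst p)" if "p \<in> A1" for p
      using that by (auto simp: A1_def f_def monic_prfs_def split: if_splits)
    moreover have "degree (fst p) \<le> degree (snd p)" if "p \<in> A2" for p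
      using that deg2 by (auto simp: A2_def g_def monic_prfs_def)
    ultimately show ?thesis by (meson disjoint_iff leD)
  qed
  have "?R = A1 \<union> A2"
  proof (intro equalityI subsetI)
    fix p assume "p \<in> ?R"
    then obtain V U where p: "p = (V, U)" and VU: "V \<noteq> 0" "lead_coeff U = 1" "coprime V U"
      "degree V \<le> 3" "degree U \<le> 3" "bij (ratfun_eval V U)"
      by (auto simp: reduced_prfs_def)
    show "p \<in> A1 \<union> A2"
    proof (cases "degree U < degree V")
      case True
      define a where "a = lead_coeff V"
      have "a \<noteq> 0"
        using VU by (simp add: a_def)
      define W where "W = smult (inverse a) V"
      have V: "V = smult a W"
        using \<open>a \<noteq> 0\<close> by (simp add: W_def)
      have "(W, U) \<in> ?B"
        using VU True \<open>a \<noteq> 0\<close> bij_ratfun_eval_smult_left[of "inverse a" V U]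
        by (simp add: monic_prfs_def W_def a_def coprime_smult_left_iff)
      then have "p \<in> A1"
        using \<open>a \<noteq> 0\<close> unfolding A1_def p V by (intro image_eqI[of _ _ "(a, W, U)"]) (auto simp: f_def)
      then show ?thesis by blast
    next
      case False
      \<comment> \<open>This a is the value at infinity, 0 included. Subtracting it leaves R/U with
        R of smaller degree, and R/U = e/(U/W) for the monic multiple W of R.\<close>
      define a where "a = coeff V (degree U)"
      define R where "R = V - smult a U"
      have "U \<noteq> 0"
        using VU by auto
      have R1: "coeff R (degree U) = 0"
        using VU(2) by (simp add: R_def a_def)
      have R2: "degree R \<le> degree U"
        unfolding R_def using False degree_smult_le[of a U] by (intro degree_diff_le) auto
      \<comment> \<open>Otherwise \<open>U\<close> divides the coprime \<open>V\<close>, so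
        \<open>U\<close> and with it V/U would be constant, which is not injective.\<close>
      have "R \<noteq> 0"
      proof
        assume "R = 0"
        then have V: "V = smult a U"
          by (simp add: R_def)
        then have "U dvd V"
          by (simp add: dvd_smult)
        from coprime_common_divisor[OF VU(3) this dvd_refl] have "U dvd 1" .
        then have "degree U = 0"
          using \<open>U \<noteq> 0\<close> by (simp add: is_unit_iff_degree)
        then obtain b where "U = [:b:]"
          by (rule degree_eq_zeroE)
        then have "ratfun_eval V U (Some 0) = ratfun_eval V U (Some 1)"
          by (simp add: V)
        with bij_is_inj[OF VU(6)] have "Some (0::'a) = Some 1"
          by (rule injD)
        then show False
          by simp
      qed
      then have "degree R \<noteq> degree U"
        using R1 leading_coeff_0_iff[of R] by metis
      with R2 have deg: "degree R < degree U"
        by simp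
      define e where "e = lead_coeff R"
      have "e \<noteq> 0"
        using \<open>R \<noteq> 0\<close> by (simp add: e_def)
      define W where "W = smult (inverse e) R"
      have V: "V = smult a U + smult e W"
        using \<open>e \<noteq> 0\<close> by (simp add: W_def R_def)
      have "degree W < degree U"
        using deg \<open>e \<noteq> 0\<close> by (simp add: W_def)
      moreover have "coprime U W"
        using VU(3) coprime_inversion[OF \<open>e \<noteq> 0\<close>, of a U W] unfolding V by blast
      moreover have "bij (ratfun_eval U W)"
        using VU(6) bij_ratfun_eval_inversion[OF \<open>coprime U W\<close> \<open>degree W < degree U\<close> \<open>e \<noteq> 0\<close>, of a]
        unfolding V by blast
      moreover have "lead_coeff W = 1"
        using \<open>e \<noteq> 0\<close> by (simp add: W_def e_def)
      ultimately have "(U, W) \<in> ?B"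
        using VU by (simp add: monic_prfs_def)
      then have "p \<in> A2"
        using \<open>e \<noteq> 0\<close> unfolding A2_def p V by (intro image_eqI[of _ _ "(a, e, U, W)"]) (auto simp: g_def)
      then show ?thesis by blast
    qed
  next
    fix p assume "p \<in> A1 \<union> A2"
    then show "p \<in> ?R"
    proof
      assume "p \<in> A1"
      then obtain z where z: "p = f z" "z \<in> (UNIV - {0}) \<times> ?B"
        unfolding A1_def by (rule imageE)
      obtain a V U where "z = (a, V, U)"
        by (metis prod_cases3)
      with z have "p = f (a, V, U)" "a \<noteq> 0" "(V, U) \<in> ?B"
        by simp_all
      then show ?thesis
        by (simp add: f_def monic_prfs_def reduced_prfs_def bij_ratfun_eval_smult_left
            coprime_smult_left_iff) auto
    next
      assume "p \<in> A2"
      then obtain z where z: "p = g z" "z \<in> UNIV \<times> (UNIV - {0}) \<times> ?B"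
        unfolding A2_def by (rule imageE)
      obtain a e V U where "z = (a, e, V, U)"
        by (metis prod_cases4)
      with z have p: "p = g (a, e, V, U)" "e \<noteq> 0" "(V, U) \<in> ?B"
        by simp_all
      then have VU: "coprime V U" "degree U < degree V" "degree V \<le> 3" "lead_coeff V = 1"
        "lead_coeff U = 1" "bij (ratfun_eval V U)"
        by (auto simp: monic_prfs_def)
      have cop: "coprime (smult a V + smult e U) V"
        using coprime_inversion[OF \<open>e \<noteq> 0\<close>, of a V U] VU(1) by blast
      have "smult a V + smult e U \<noteq> 0"
      proof
        assume "smult a V + smult e U = 0"
        then have "V dvd 1"
          using cop by simp
        moreover have "V \<noteq> 0"
          using VU(2) by auto
        ultimately show False
          using VU(2) by (simp add: is_unit_iff_degree)
      qed
      moreover have "bij (ratfun_eval (smult a V + smult e U) V)"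
        using bij_ratfun_eval_inversion[OF VU(1,2) \<open>e \<noteq> 0\<close>, of a] VU(6) by blast
      ultimately show ?thesis
        using cop VU deg2[OF VU(2), of a e] by (simp add: reduced_prfs_def p(1) g_def)
    qed
  qed
  moreover have "finite A1" "finite A2"
    unfolding A1_def A2_def
    by (intro finite_imageI finite_cartesian_product finite_monic_prfs finite; simp)+
  ultimately have "card ?R = card A1 + card A2"
    using card_Un_disjoint[OF _ _ disj] by metis
  also have "\<dots> = (CARD('a) - 1) * (CARD('a) + 1) * card ?B"
    unfolding A1 A2 by (simp add: algebra_simps)
  also have "(CARD('a) - 1) * (CARD('a) + 1) = CARD('a)\<^sup>2 - 1"
    by (simp add: power2_eq_square algebra_simps)
  finally show ?thesis .
qed

section \<open>Counting\<close>

text \<open>Infinity is already a preimage of itself, so injectivity forbids any pole in the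
  field.\<close>

lemma bij_ratfun_eval_iff:
  fixes V U :: "'a::{field,finite} poly"
  assumes "degree U < degree V"
  shows "bij (ratfun_eval V U) \<longleftrightarrow> (\<forall>x. poly U x \<noteq> 0) \<and> bij (\<lambda>x. poly V x / poly U x)"
  unfolding bij_finite_iff_inj inj_def split_option_all using assms by (auto split: if_splits)

lemma monic_degree_1: "\<exists>b. p = [:b, 1:]" if "degree p = 1" "lead_coeff p = 1"
  using that by (intro exI[of _ "coeff p 0"] poly_eqI)
    (auto simp: coeff_pCons coeff_eq_0 split: nat.splits)

lemma monic_degree_2: "\<exists>a b. p = [:b, a, 1:]" if "degree p = 2" "lead_coeff p = 1"
  using that by (intro exI[of _ "coeff p 1"] exI[of _ "coeff p 0"] poly_eqI)
    (auto simp: coeff_pCons coeff_eq_0 eval_nat_numeral split: nat.splits)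

lemma monic_degree_3: "\<exists>a b c. p = [:c, b, a, 1:]" if "degree p = 3" "lead_coeff p = 1"
  using that by (intro exI[of _ "coeff p 2"] exI[of _ "coeff p 1"] exI[of _ "coeff p 0"] poly_eqI)
    (auto simp: coeff_pCons coeff_eq_0 eval_nat_numeral split: nat.splits)

lemma monic_prfs_polynomial_iff:
  fixes V :: "'a::{field,finite} poly"
  assumes "0 < degree V" "degree V \<le> 3" "lead_coeff V = 1"
  shows "(V, 1) \<in> monic_prfs \<longleftrightarrow> bij (poly V)"
  using assms by (simp add: monic_prfs_def bij_ratfun_eval_iff)

text \<open>\<open>V\<close> is given by its quotient and remainder modulo \<open>U\<close>, so that
  V/U = x + b + r/U. The constant b only translates, and the remainder alone decides.\<close>

lemma monic_prfs_quadratic_iff: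
  fixes u w b r0 r1 :: "'a::{field,finite}"
  assumes "primepow CARD('a)" and "CARD('a) > 4"
  defines "V \<equiv> [:w, u, 1:] * [:b, 1:] + [:r0, r1:]"
  shows "(V, [:w, u, 1:]) \<in> monic_prfs \<longleftrightarrow>
    (u, w) \<in> rootless_quadratics \<and> r1 = 2 * (4 * w - u\<^sup>2) \<and> r0 = u * (4 * w - u\<^sup>2)"
proof -
  let ?U = "[:w, u, 1:]"
  have poly_U: "poly ?U x = x\<^sup>2 + u * x + w" for x
    by (simp add: power2_eq_square algebra_simps)
  have "V = [:w * b + r0, u * b + w + r1, b + u, 1:]"
    by (simp add: V_def algebra_simps)
  then have V: "degree V = 3" "lead_coeff V = 1"
    by simp_all
  have rootless: "(u, w) \<in> rootless_quadratics \<longleftrightarrow> (\<forall>x. poly ?U x \<noteq> 0)"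
    by (simp only: rootless_quadratics_def poly_U mem_Collect_eq case_prod_conv)
  have eval: "bij (\<lambda>x. poly V x / poly ?U x) \<longleftrightarrow> bij (\<lambda>x. x + (r1 * x + r0) / (x\<^sup>2 + u * x + w))"
    if "\<forall>x. poly ?U x \<noteq> 0"
  proof -
    have "poly V x / poly ?U x = x + (r1 * x + r0) / (x\<^sup>2 + u * x + w) + b" for x
    proof -
      have "poly V x = (x + b) * poly ?U x + (r1 * x + r0)"
        unfolding V_def poly_add poly_mult by (simp add: algebra_simps)
      then have "poly V x / poly ?U x = x + b + (r1 * x + r0) / poly ?U x"
        using that by (simp only: add_divide_distrib[of _ "r1 * x + r0"]) simp
      then show ?thesis
        unfolding poly_U by simp
    qed
    then show ?thesis
      by (simp only: bij_plus_const_iff)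
  qed
  show ?thesis
  proof
    assume mem: "(V, ?U) \<in> monic_prfs"
    then have "bij (ratfun_eval V ?U)" "coprime V ?U" and deg: "degree ?U < degree V"
      by (auto simp: monic_prfs_def)
    then have nr: "\<forall>x. poly ?U x \<noteq> 0" and "bij (\<lambda>x. poly V x / poly ?U x)"
      using bij_ratfun_eval_iff[OF deg] by blast+
    then have bij: "bij (\<lambda>x. x + (r1 * x + r0) / (x\<^sup>2 + u * x + w))"
      using eval by blast
    have "r1 \<noteq> 0 \<or> r0 \<noteq> 0"
    proof (rule ccontr)
      assume "\<not> (r1 \<noteq> 0 \<or> r0 \<noteq> 0)"
      then have r: "r1 = 0" "r0 = 0"
        by simp_all
      have "V = ?U * [:b, 1:] + 0"
        unfolding V_def r by (simp only: pCons_0_0)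
      then have "?U dvd V"
        by (simp only: add_0_right dvd_triv_left)
      then have "is_unit ?U"
        using \<open>coprime V ?U\<close> by (metis coprime_common_divisor dvd_refl)
      then show False
        by (simp add: is_unit_iff_degree)
    qed
    then show "(u, w) \<in> rootless_quadratics \<and> r1 = 2 * (4 * w - u\<^sup>2) \<and> r0 = u * (4 * w - u\<^sup>2)"
      using quadratic_perm_iff[OF assms(1,2), of u w r1 r0] bij nr unfolding rootless poly_U by blast
  next
    assume *: "(u, w) \<in> rootless_quadratics \<and> r1 = 2 * (4 * w - u\<^sup>2) \<and> r0 = u * (4 * w - u\<^sup>2)"
    then have nr: "x\<^sup>2 + u * x + w \<noteq> 0" for x
      by (auto simp: rootless_quadratics_def)
    then have nr': "\<forall>x. poly ?U x \<noteq> 0"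
      unfolding poly_U by blast
    have r: "r1 = 2 * (4 * w - u\<^sup>2)" "r0 = u * (4 * w - u\<^sup>2)"
      using * by blast+
    have nz: "r1 \<noteq> 0 \<or> r0 \<noteq> 0"
      unfolding r by (rule quadratic_numerator_nonzero[OF nr])
    have "bij (\<lambda>x. x + (r1 * x + r0) / (x\<^sup>2 + u * x + w))"
      using quadratic_perm_iff[OF assms(1,2) nr nz] * by blast
    then have bij: "bij (ratfun_eval V ?U)"
      using V nr' eval[OF nr'] by (subst bij_ratfun_eval_iff) simp_all
    \<comment> \<open>As \<open>U\<close> is irreducible, coprimality reduces to this, and a nonzero
      remainder of degree at most 1 is not a multiple of \<open>U\<close>.\<close>
    have "\<not> ?U dvd V"
    proof
      assume "?U dvd V"
      then have "?U dvd [:r0, r1:]"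
        unfolding V_def by (simp only: dvd_add_right_iff dvd_triv_left)
      moreover have "[:r0, r1:] \<noteq> 0"
        using nz by auto
      ultimately have "degree ?U \<le> degree [:r0, r1:]"
        by (rule dvd_imp_degree_le)
      then show False
        by (simp split: if_splits)
    qed
    have irr: "irreducible ?U"
      by (rule prime_elem_imp_irreducible[OF prime_elem_quadratic[OF nr]])
    have "coprime V ?U"
    proof (rule coprimeI)
      fix d assume d: "d dvd V" "d dvd ?U"
      from d(2) obtain k where k: "?U = d * k"
        by (rule dvdE)
      have "\<not> is_unit k"
      proof
        assume "is_unit k"
        then have "?U dvd d"
          unfolding k by (simp add: mult_unit_dvd_iff)
        with d(1) \<open>\<not> ?U dvd V\<close> show False
          using dvd_trans by blast
      qed
      then show "is_unit d"
        using irreducibleD[OF irr k] by blast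
    qed
    then show "(V, ?U) \<in> monic_prfs"
      using V bij by (simp add: monic_prfs_def)
  qed
qed

text \<open>The summands stand for linear, quadratic and cubic polynomials and for quadratic
  denominators, where b is free. A linear denominator would have a root. The degrees keep the
  families disjoint.\<close>

lemma card_monic_prfs:
  assumes pp: "primepow CARD('a::{field,finite})" and q: "CARD('a) > 4"
  shows "card (monic_prfs :: ('a poly \<times> 'a poly) set) =
    CARD('a) + card {(a, c). bij (\<lambda>x::'a. x\<^sup>2 + a * x + c)}
    + card {(a, b, c). bij (\<lambda>x::'a. x ^ 3 + a * x\<^sup>2 + b * x + c)}
    + CARD('a) * card (rootless_quadratics :: ('a \<times> 'a) set)"
proof -
  let ?C2 = "{(a, c). bij (\<lambda>x::'a. x\<^sup>2 + a * x + c)}"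
  let ?C3 = "{(a, b, c). bij (\<lambda>x::'a. x ^ 3 + a * x\<^sup>2 + b * x + c)}"
  define f1 where "f1 = (\<lambda>b :: 'a. ([:b, 1:], 1 :: 'a poly))"
  define f2 where "f2 = (\<lambda>(a :: 'a, c :: 'a). ([:c, a, 1:], 1 :: 'a poly))"
  define f3 where "f3 = (\<lambda>(a :: 'a, b :: 'a, c :: 'a). ([:c, b, a, 1:], 1 :: 'a poly))"
  define f4 where "f4 = (\<lambda>((u :: 'a, w :: 'a), b :: 'a).
    ([:w, u, 1:] * [:b, 1:] + [:u * (4 * w - u\<^sup>2), 2 * (4 * w - u\<^sup>2):], [:w, u, 1:]))"
  define B1 where "B1 = range f1"
  define B2 where "B2 = f2 ` ?C2"
  define B3 where "B3 = f3 ` ?C3"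
  define B4 where "B4 = f4 ` (rootless_quadratics \<times> UNIV)"
  have p1: "bij (poly [:b, 1:])" for b :: 'a
    by (simp add: bij_finite_iff_inj inj_def)
  have p2: "poly [:c, a, 1:] = (\<lambda>x. x\<^sup>2 + a * x + c)" for a c :: 'a
    by (simp add: fun_eq_iff power2_eq_square algebra_simps)
  have p3: "poly [:c, b, a, 1:] = (\<lambda>x. x ^ 3 + a * x\<^sup>2 + b * x + c)" for a b c :: 'a
    by (simp add: fun_eq_iff power2_eq_square power3_eq_cube algebra_simps)
  have m1: "([:b, 1:], 1) \<in> monic_prfs" for b :: 'a
    using p1 by (subst monic_prfs_polynomial_iff) simp_all
  have m2: "([:c, a, 1:], 1) \<in> monic_prfs \<longleftrightarrow> (a, c) \<in> ?C2" for a c :: 'a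
    by (subst monic_prfs_polynomial_iff) (simp_all add: p2 del: poly_pCons)
  have m3: "([:c, b, a, 1:], 1) \<in> monic_prfs \<longleftrightarrow> (a, b, c) \<in> ?C3" for a b c :: 'a
    by (subst monic_prfs_polynomial_iff) (simp_all add: p3 del: poly_pCons)
  have "monic_prfs = B1 \<union> B2 \<union> B3 \<union> B4"
  proof (intro equalityI subsetI)
    fix p :: "'a poly \<times> 'a poly" assume mem: "p \<in> monic_prfs"
    then obtain V U where p: "p = (V, U)" and VU: "lead_coeff V = 1" "lead_coeff U = 1"
      "degree U < degree V" "degree V \<le> 3" "bij (ratfun_eval V U)"
      by (auto simp: monic_prfs_def)
    have nr: "poly U x \<noteq> 0" for x
      using VU by (simp add: bij_ratfun_eval_iff)
    consider "degree U = 0" | "degree U = 1" | "degree U = 2" "degree V = 3"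
      using VU by linarith
    then show "p \<in> B1 \<union> B2 \<union> B3 \<union> B4"
    proof cases
      case 1
      then have U: "U = 1"
        using VU(2) by (metis degree_eq_zeroE lead_coeff_pCons(2) one_pCons degree_0_id of_nat_1)
      consider "degree V = 1" | "degree V = 2" | "degree V = 3"
        using VU 1 by linarith
      then show ?thesis
      proof cases
        case 1
        with VU show ?thesis
          unfolding p U using monic_degree_1 by (force simp: B1_def f1_def)
      next
        case 2
        then obtain a c where "V = [:c, a, 1:]"
          using VU monic_degree_2 by blast
        then have "p = f2 (a, c)" "(a, c) \<in> ?C2"
          using mem m2 by (simp_all only: p U f2_def case_prod_conv)
        then show ?thesis
          unfolding B2_def by blast
      next
        case 3
        then obtain a b c where "V = [:c, b, a, 1:]"
          using VU monic_degree_3 by blast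
        then have "p = f3 (a, b, c)" "(a, b, c) \<in> ?C3"
          using mem m3 by (simp_all only: p U f3_def case_prod_conv)
        then show ?thesis
          unfolding B3_def by blast
      qed
    next
      case 2
      then obtain b where "U = [:b, 1:]"
        using VU monic_degree_1 by blast
      then show ?thesis
        using nr[of "- b"] by simp
    next
      case 3
      then obtain u w where U: "U = [:w, u, 1:]"
        using VU monic_degree_2 by blast
      obtain v0 v1 v2 where V: "V = [:v0, v1, v2, 1:]"
        using VU 3 monic_degree_3 by blast
      define b where "b = v2 - u"
      define r1 r0 where "r1 = v1 - w - b * u" and "r0 = v0 - b * w"
      have V': "V = [:w, u, 1:] * [:b, 1:] + [:r0, r1:]"
        by (simp add: V b_def r1_def r0_def algebra_simps)
      have "(u, w) \<in> rootless_quadratics" "r1 = 2 * (4 * w - u\<^sup>2)" "r0 = u * (4 * w - u\<^sup>2)"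
        using mem monic_prfs_quadratic_iff[OF pp q, of w u b r0 r1] unfolding p U V' by blast+
      then have "p = f4 ((u, w), b)" "((u, w), b) \<in> rootless_quadratics \<times> UNIV"
        unfolding p U V' f4_def by auto
      then show ?thesis
        unfolding B4_def by blast
    qed
  next
    fix p assume "p \<in> B1 \<union> B2 \<union> B3 \<union> B4"
    then consider "p \<in> B1" | "p \<in> B2" | "p \<in> B3" | "p \<in> B4"
      by blast
    then show "p \<in> monic_prfs"
    proof cases
      case 1
      then show ?thesis
        using m1 by (auto simp: B1_def f1_def)
    next
      case 2
      then show ?thesis
        using m2 unfolding B2_def f2_def by force
    next
      case 3
      then show ?thesis
        using m3 unfolding B3_def f3_def by force
    next
      case 4
      then obtain u w b where "(u, w) \<in> rootless_quadratics" "p = f4 ((u, w), b)"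
        unfolding B4_def by force
      then show ?thesis
        using monic_prfs_quadratic_iff[OF pp q] unfolding f4_def case_prod_conv by blast
    qed
  qed
  moreover have "card B1 = CARD('a)"
    unfolding B1_def by (intro card_image) (auto simp: inj_def f1_def)
  moreover have "card B2 = card ?C2"
    unfolding B2_def by (intro card_image) (auto simp: inj_on_def f2_def)
  moreover have "card B3 = card ?C3"
    unfolding B3_def by (intro card_image) (auto simp: inj_on_def f3_def)
  moreover have "card B4 = card (rootless_quadratics :: ('a \<times> 'a) set) * CARD('a)"
  proof -
    have "inj_on f4 (rootless_quadratics \<times> UNIV)"
      by (auto simp: inj_on_def f4_def)
    then show ?thesis
      unfolding B4_def by (simp only: card_image card_cartesian_product)
  qed
  moreover have "degree (fst p) = 1 \<and> degree (snd p) = 0" if "p \<in> B1" for p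
    using that by (auto simp: B1_def f1_def)
  moreover have "degree (fst p) = 2 \<and> degree (snd p) = 0" if "p \<in> B2" for p
    using that by (auto simp: B2_def f2_def)
  moreover have "degree (fst p) = 3 \<and> degree (snd p) = 0" if "p \<in> B3" for p
    using that by (auto simp: B3_def f3_def)
  moreover have "degree (snd p) = 2" if "p \<in> B4" for p
    using that by (auto simp: B4_def f4_def)
  ultimately show ?thesis
  proof -
    assume eq: "monic_prfs = B1 \<union> B2 \<union> B3 \<union> B4"
      and cards: "card B1 = CARD('a)" "card B2 = card ?C2" "card B3 = card ?C3"
        "card B4 = card (rootless_quadratics :: ('a \<times> 'a) set) * CARD('a)"
      and d1: "\<And>p. p \<in> B1 \<Longrightarrow> degree (fst p) = 1 \<and> degree (snd p) = 0"
      and d2: "\<And>p. p \<in> B2 \<Longrightarrow> degree (fst p) = 2 \<and> degree (snd p) = 0"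
      and d3: "\<And>p. p \<in> B3 \<Longrightarrow> degree (fst p) = 3 \<and> degree (snd p) = 0"
      and d4: "\<And>p. p \<in> B4 \<Longrightarrow> degree (snd p) = 2"
    have fin: "finite B1" "finite B2" "finite B3" "finite B4"
      by (simp_all add: B1_def B2_def B3_def B4_def)
    have "B1 \<inter> B2 = {}"
      using d1 d2 by fastforce
    moreover have "(B1 \<union> B2) \<inter> B3 = {}"
      using d1 d2 d3 by fastforce
    moreover have "(B1 \<union> B2 \<union> B3) \<inter> B4 = {}"
      using d1 d2 d3 d4 by fastforce
    ultimately show ?thesis
      unfolding eq using fin cards by (simp add: card_Un_disjoint mult.commute)
  qed
qed

section \<open>Numbers of monic permutation polynomials of degree two and three\<close>

lemma card_quadratic_perms:
  assumes "primepow CARD('a::{field,finite})"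
  shows "card {(a, c). bij (\<lambda>x::'a. x\<^sup>2 + a * x + c)} = (if even CARD('a) then CARD('a) else 0)"
proof -
  have "{(a, c). bij (\<lambda>x::'a. x\<^sup>2 + a * x + c)} = (if even CARD('a) then {0} \<times> UNIV else {})"
    using two_eq_0_iff[OF assms] by (auto simp: quadratic_poly_perm_iff)
  then show ?thesis
    by (simp add: card_cartesian_product)
qed

lemma card_cubic_perms:
  assumes pp: "primepow CARD('a::{field,finite})" and q: "CARD('a) > 3" and three: "CARD('a) mod 3 \<noteq> 0"
  shows "card {(a, b, c). bij (\<lambda>x::'a. x ^ 3 + a * x\<^sup>2 + b * x + c)} =
    (if CARD('a) mod 3 = 2 then CARD('a)\<^sup>2 else 0)"
proof -
  have 3: "(3::'a) \<noteq> 0"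
    using three_eq_0_iff[OF pp] three by simp
  show ?thesis
  proof (cases "CARD('a) mod 3 = 2")
    case True
    have "3 * b = a\<^sup>2 \<longleftrightarrow> b = a\<^sup>2 / 3" for a b :: 'a
      by (simp only: nonzero_eq_divide_eq[OF 3] mult.commute[of b])
    then have "{(a, b, c). bij (\<lambda>x::'a. x ^ 3 + a * x\<^sup>2 + b * x + c)} = {(a, b, c). b = a\<^sup>2 / 3}"
      by (simp only: cubic_perm_iff[OF pp q 3] True simp_thms)
    also have "\<dots> = (\<lambda>(a, c). (a, a\<^sup>2 / 3, c)) ` UNIV"
    proof (intro equalityI subsetI)
      fix p :: "'a \<times> 'a \<times> 'a" assume "p \<in> {(a, b, c). b = a\<^sup>2 / 3}"
      then have "p = (\<lambda>(a, c). (a, a\<^sup>2 / 3, c)) (fst p, snd (snd p))"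
        by auto
      then show "p \<in> (\<lambda>(a, c). (a, a\<^sup>2 / 3, c)) ` UNIV"
        by blast
    qed auto
    finally have "{(a, b, c). bij (\<lambda>x::'a. x ^ 3 + a * x\<^sup>2 + b * x + c)} =
        (\<lambda>(a, c). (a, a\<^sup>2 / 3, c)) ` UNIV" .
    moreover have "inj (\<lambda>(a :: 'a, c :: 'a). (a, a\<^sup>2 / 3, c))"
      by (auto simp: inj_def)
    ultimately show ?thesis
      using True by (simp add: card_image power2_eq_square)
  next
    case False
    then show ?thesis
      by (simp add: cubic_perm_iff[OF pp q 3])
  qed
qed

text \<open>Here a = 0, c is free, and -b avoids the (q - 1)/2 nonzero squares, which leaves (q +
  1)/2 choices of b.\<close>

lemma card_cubic_perms_char_3:
  assumes pp: "primepow CARD('a::{field,finite})" and three: "CARD('a) mod 3 = 0"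
  shows "2 * card {(a, b, c). bij (\<lambda>x::'a. x ^ 3 + a * x\<^sup>2 + b * x + c)} = CARD('a) * (CARD('a) + 1)"
proof -
  let ?Q = "(\<lambda>x::'a. x\<^sup>2) ` (UNIV - {0})"
  have 3: "(3::'a) = 0"
    using three_eq_0_iff[OF pp] three by simp
  have "(2::'a) \<noteq> 0"
  proof
    assume 2: "(2::'a) = 0"
    have "(1::'a) = 3 - 2" by simp
    then show False unfolding 2 3 by simp
  qed
  then have Q: "2 * card ?Q = CARD('a) - 1"
    by (rule card_nonzero_squares)
  have "{(a, b, c). bij (\<lambda>x::'a. x ^ 3 + a * x\<^sup>2 + b * x + c)} =
      {0} \<times> (uminus ` (UNIV - ?Q)) \<times> UNIV"
    by (auto simp: cubic_perm_iff_char_3[OF 3] intro!: image_eqI[of _ uminus "- b" for b])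
  then have "card {(a, b, c). bij (\<lambda>x::'a. x ^ 3 + a * x\<^sup>2 + b * x + c)} = (CARD('a) - card ?Q) * CARD('a)"
    by (simp only: card_cartesian_product) (simp add: card_image card_Diff_subset)
  moreover have "2 * (CARD('a) - card ?Q) = CARD('a) + 1"
    using Q zero_less_card_finite[where 'a='a] by linarith
  ultimately show ?thesis
    by (simp only: mult.assoc[symmetric]) (simp only: mult.commute)
qed

section \<open>The permutation code\<close>

text \<open>Homogenised in degree n, the value at infinity is the ratio of the two coefficients of
  X^n. It is stated multiplied out because both may vanish.\<close>

lemma ratfun_eval_infinity:
  fixes V U :: "'a::field poly"
  assumes "degree V \<le> n" "degree U \<le> n" "lead_coeff U = 1"
  shows "case ratfun_eval V U None of None \<Rightarrow> coeff U n = 0 | Some c \<Rightarrow> coeff V n = c * coeff U n"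
proof -
  consider "degree U < degree V" | "degree V < degree U" | "degree V = degree U"
    by linarith
  then show ?thesis
  proof cases
    case 1
    then show ?thesis
      using assms by (simp add: coeff_eq_0)
  next
    case 2
    then show ?thesis
      using assms by (simp add: coeff_eq_0)
  next
    case 3
    then show ?thesis
      using assms by (cases "degree U = n") (simp_all add: coeff_eq_0)
  qed
qed

lemma coeff_mult_top:
  fixes p r :: "'a::comm_semiring_1 poly"
  assumes "degree p \<le> n" "degree r \<le> n"
  shows "coeff (p * r) (2 * n) = coeff p n * coeff r n"
proof -
  have "coeff p i * coeff r (2 * n - i) = (if i = n then coeff p n * coeff r n else 0)" for i
  proof -
    consider "i < n" | "i = n" | "n < i"
      by linarith
    then show ?thesis
      using assms by cases (simp_all add: coeff_eq_0 mult_2)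
  qed
  then show ?thesis
    unfolding coeff_mult by simp
qed

text \<open>The cross product \<open>V U' - V' U\<close> is a binary form of degree at most 6; it vanishes at
  infinity iff its coefficient of degree 6 is zero.\<close>

lemma card_agreement_le:
  fixes V U V' U' :: "'a::{field,finite} poly"
  assumes VU: "(V, U) \<in> reduced_prfs" "(V', U') \<in> reduced_prfs" and ne: "(V, U) \<noteq> (V', U')"
  shows "card {x. ratfun_eval V U x = ratfun_eval V' U' x} \<le> 6"
proof -
  define W where "W = V * U' - V' * U"
  have deg: "degree V \<le> 3" "degree U \<le> 3" "degree V' \<le> 3" "degree U' \<le> 3"
    and lead: "lead_coeff U = 1" "lead_coeff U' = 1" and nz: "V \<noteq> 0" "V' \<noteq> 0"
    and cop: "coprime V U" "coprime V' U'"
    using VU by (auto simp: reduced_prfs_def)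
  have "W \<noteq> 0"
    using coprime_monic_cross_eq[OF cop lead] ne by (auto simp: W_def)
  have degW: "degree W \<le> 6"
    unfolding W_def using degree_mult_le[of V U'] degree_mult_le[of V' U] deg
    by (intro degree_diff_le) linarith+
  have fin: "finite {x. poly W x = 0}"
    using \<open>W \<noteq> 0\<close> by (rule poly_roots_finite)
  have roots: "card {x. poly W x = 0} \<le> degree W"
    using \<open>W \<noteq> 0\<close> by (rule card_poly_roots_bound)
  let ?Z = "{x. ratfun_eval V U x = ratfun_eval V' U' x}"
  \<comment> \<open>A common value of infinity also counts: then both denominators vanish at x, and
    so does \<open>W\<close>.\<close>
  have some: "poly W x = 0" if "ratfun_eval V U (Some x) = ratfun_eval V' U' (Some x)" for x
    using that by (simp add: W_def frac_eq_eq split: if_splits)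
  have sub: "?Z \<subseteq> insert None (Some ` {x. poly W x = 0})"
  proof
    fix z assume "z \<in> ?Z"
    then have z: "ratfun_eval V U z = ratfun_eval V' U' z"
      by simp
    show "z \<in> insert None (Some ` {x. poly W x = 0})"
    proof (cases z)
      case (Some y)
      then have "poly W y = 0"
        using z some by blast
      then show ?thesis
        unfolding Some by blast
    qed simp
  qed
  have card_Some: "card (Some ` {x. poly W x = 0}) \<le> degree W"
    using roots card_image_le[OF fin, of Some] by linarith
  show ?thesis
  proof (cases "None \<in> ?Z")
    case False
    with sub have "?Z \<subseteq> Some ` {x. poly W x = 0}"
      by blast
    then have "card ?Z \<le> card (Some ` {x. poly W x = 0})"
      using fin by (intro card_mono finite_imageI)
    then show ?thesis
      using card_Some degW by linarith
  next
    case True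
    then have eq: "ratfun_eval V U None = ratfun_eval V' U' None"
      by (rule CollectD)
    have "coeff V 3 * coeff U' 3 = coeff V' 3 * coeff U 3"
      using ratfun_eval_infinity[OF deg(1,2) lead(1), unfolded eq]
        ratfun_eval_infinity[OF deg(3,4) lead(2)]
      by (cases "ratfun_eval V' U' None") (simp_all del: ratfun_eval.simps)
    then have "coeff W 6 = 0"
      using coeff_mult_top[OF deg(1,4)] coeff_mult_top[OF deg(3,2)] by (simp add: W_def)
    then have "degree W \<noteq> 6"
      using \<open>W \<noteq> 0\<close> leading_coeff_0_iff[of W] by metis
    then have "degree W \<le> 5"
      using degW by linarith
    have "card ?Z \<le> card (insert None (Some ` {x. poly W x = 0}))"
      using fin sub by (intro card_mono) simp_all
    also have "\<dots> \<le> Suc (card (Some ` {x. poly W x = 0}))"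
      using fin by (simp add: card_insert_if)
    finally show ?thesis
      using card_Some \<open>degree W \<le> 5\<close> by linarith
  qed
qed

section \<open>From families of bijections to permutation codes\<close>

lemma max_perm_code_ge:
  assumes "perm_code n D C"
  shows "card C \<le> max_perm_code n D"
proof -
  have "{C. perm_code n D C} \<subseteq> Pow {\<pi>. \<pi> permutes {..<n}}"
    by (auto simp: perm_code_def)
  then have "finite {C. perm_code n D C}"
    by (rule finite_subset) (simp add: finite_permutations)
  then have "finite (card ` {C. perm_code n D C})"
    by (rule finite_imageI)
  moreover have "card ` {C. perm_code n D C} = {card C | C. perm_code n D C}"
    by auto
  ultimately show ?thesis
    unfolding max_perm_code_def using assms by (intro Max_ge) auto
qed

lemma max_perm_code_ge_bijections:
  fixes F :: "('b::finite \<Rightarrow> 'b) set"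
  assumes bij: "\<And>f. f \<in> F \<Longrightarrow> bij f"
    and agree: "\<And>f g. f \<in> F \<Longrightarrow> g \<in> F \<Longrightarrow> f \<noteq> g \<Longrightarrow> card {x. f x = g x} + D \<le> CARD('b)"
  shows "card F \<le> max_perm_code CARD('b) D"
proof -
  let ?n = "CARD('b)"
  obtain e :: "'b \<Rightarrow> nat" where e: "bij_betw e UNIV {..<?n}"
    using ex_bij_betw_finite_nat[of "UNIV :: 'b set"] by (auto simp: atLeast0LessThan)
  define e' where "e' = inv_into UNIV e"
  have e': "bij_betw e' {..<?n} UNIV"
    unfolding e'_def by (rule bij_betw_inv_into[OF e])
  have e'_e: "e' (e x) = x" for x
    unfolding e'_def using e by (simp add: bij_betw_inv_into_left)
  have e_less: "e x < ?n" for x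
    using e by (auto simp: bij_betw_def)
  \<comment> \<open>Conjugation by an enumeration of the points, continued by the identity because
    \<open>permutes\<close> demands it outside the set.\<close>
  define P where "P = (\<lambda>f x. if x < ?n then e (f (e' x)) else x)"
  have P_e: "P f (e x) = e (f x)" for f x
    by (simp add: P_def e_less e'_e)
  have perm: "P f permutes {..<?n}" if "bij f" for f
  proof (rule bij_imp_permutes)
    have "bij_betw (e \<circ> (f \<circ> e')) {..<?n} {..<?n}"
      by (intro bij_betw_trans[OF bij_betw_trans[OF e' that] e])
    then show "bij_betw (P f) {..<?n} {..<?n}"
      by (subst bij_betw_cong[of _ _ "e \<circ> (f \<circ> e')"]) (auto simp: P_def)
  qed (simp add: P_def)
  have inj_e: "e x = e y \<longleftrightarrow> x = y" for x y
    using e by (auto simp: bij_betw_def inj_def)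
  have ham: "hamming_dist ?n (P f) (P g) + card {x. f x = g x} = ?n" for f g
  proof -
    have "{x. x < ?n \<and> P f x \<noteq> P g x} = e ` {x. f x \<noteq> g x}"
    proof (intro equalityI subsetI)
      fix y assume y: "y \<in> {x. x < ?n \<and> P f x \<noteq> P g x}"
      then obtain x where "y = e x"
        using e by (auto simp: bij_betw_def)
      then show "y \<in> e ` {x. f x \<noteq> g x}"
        using y by (auto simp: P_e)
    qed (auto simp: P_e e_less inj_e)
    then have "hamming_dist ?n (P f) (P g) = card {x. f x \<noteq> g x}"
      unfolding hamming_dist_def by (simp add: card_image inj_on_def inj_e)
    moreover have "card {x. f x \<noteq> g x} + card {x. f x = g x} = card ({x. f x \<noteq> g x} \<union> {x. f x = g x})"
      by (rule card_Un_disjoint[symmetric]) auto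
    moreover have "{x. f x \<noteq> g x} \<union> {x. f x = g x} = UNIV"
      by auto
    ultimately show ?thesis by simp
  qed
  have inj: "inj_on P F"
  proof (rule inj_onI)
    fix f g assume "P f = P g"
    then have "e (f x) = e (g x)" for x
      by (metis P_e)
    then show "f = g"
      by (auto simp: inj_e)
  qed
  have "perm_code ?n D (P ` F)"
    unfolding perm_code_def
  proof (intro conjI ballI impI)
    fix \<pi> assume "\<pi> \<in> P ` F"
    then show "\<pi> permutes {..<?n}"
      using perm bij by auto
  next
    fix \<pi> \<sigma> assume "\<pi> \<in> P ` F" "\<sigma> \<in> P ` F" "\<pi> \<noteq> \<sigma>"
    then obtain f g where fg: "f \<in> F" "g \<in> F" "f \<noteq> g" "\<pi> = P f" "\<sigma> = P g"
      by auto
    show "D \<le> hamming_dist ?n \<pi> \<sigma>"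
      using agree[OF fg(1-3)] ham[of f g] unfolding fg by linarith
  qed
  then have "card (P ` F) \<le> max_perm_code ?n D"
    by (rule max_perm_code_ge)
  then show ?thesis
    by (simp add: card_image inj)
qed

text \<open>The q + 1 points exceed six, so different pairs induce different maps, and 6 + (q - 5) =
  q + 1 gives the distance.\<close>

lemma max_perm_code_ge_T5:
  assumes q: "CARD('a::{field,finite}) > 5"
  shows "T5 TYPE('a) \<le> max_perm_code (CARD('a) + 1) (CARD('a) - 5)"
proof -
  let ?R = "reduced_prfs :: ('a poly \<times> 'a poly) set"
  let ?ev = "\<lambda>(V, U). ratfun_eval V U :: 'a option \<Rightarrow> 'a option"
  have agree: "card {x. ?ev p x = ?ev p' x} \<le> 6" if "p \<in> ?R" "p' \<in> ?R" "p \<noteq> p'" for p p'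
    using card_agreement_le that by (cases p; cases p') auto
  have "inj_on ?ev ?R"
  proof (rule inj_onI, rule ccontr)
    fix p p' assume "p \<in> ?R" "p' \<in> ?R" "?ev p = ?ev p'" "p \<noteq> p'"
    then have "CARD('a option) \<le> 6"
      using agree[of p p'] by simp
    then show False
      using q by simp
  qed
  then have "T5 TYPE('a) = card (?ev ` ?R)"
    by (simp add: T5_eq_card card_image)
  also have "\<dots> \<le> max_perm_code CARD('a option) (CARD('a) - 5)"
  proof (rule max_perm_code_ge_bijections)
    show "bij f" if "f \<in> ?ev ` ?R" for f
      using that by (auto simp: reduced_prfs_def)
    show "card {x. f x = g x} + (CARD('a) - 5) \<le> CARD('a option)"
      if fg: "f \<in> ?ev ` ?R" "g \<in> ?ev ` ?R" "f \<noteq> g" for f g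
    proof -
      obtain p p' where "p \<in> ?R" "p' \<in> ?R" "f = ?ev p" "g = ?ev p'"
        using fg by blast
      then have "card {x. f x = g x} \<le> 6"
        using agree[of p p'] \<open>f \<noteq> g\<close> by auto
      then show ?thesis
        using q by simp
    qed
  qed
  finally show ?thesis by simp
qed

section \<open>The closed formulas\<close>

lemma real_T5:
  assumes pp: "primepow CARD('a::{field,finite})" and q: "CARD('a) > 4"
  shows "real (T5 TYPE('a)) = (real CARD('a) ^ 2 - 1) *
    (real CARD('a) + (if even CARD('a) then real CARD('a) else 0)
     + (if CARD('a) mod 3 = 0 then real CARD('a) * (real CARD('a) + 1) / 2
        else if CARD('a) mod 3 = 2 then real CARD('a) ^ 2 else 0)
     + real CARD('a) ^ 2 * (real CARD('a) - 1) / 2)"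
proof -
  let ?q = "CARD('a)"
  let ?C3 = "{(a, b, c). bij (\<lambda>x::'a. x ^ 3 + a * x\<^sup>2 + b * x + c)}"
  have C3: "real (card ?C3) = (if ?q mod 3 = 0 then real ?q * (real ?q + 1) / 2
      else if ?q mod 3 = 2 then real ?q ^ 2 else 0)"
  proof (cases "?q mod 3 = 0")
    case True
    have "real (2 * card ?C3) = real (?q * (?q + 1))"
      using card_cubic_perms_char_3[OF pp True] by (simp only:)
    then have "2 * real (card ?C3) = real ?q * (real ?q + 1)"
      by (simp only: of_nat_mult of_nat_add of_nat_numeral of_nat_1)
    then show ?thesis
      using True by simp
  next
    case False
    then show ?thesis
      using card_cubic_perms[OF pp _ False] q by simp
  qed
  have "real (2 * card (rootless_quadratics :: ('a \<times> 'a) set)) = real (?q * (?q - 1))"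
    by (simp only: card_rootless_quadratics)
  then have irr: "real (card (rootless_quadratics :: ('a \<times> 'a) set)) = real ?q * (real ?q - 1) / 2"
    using q by (simp add: of_nat_diff)
  have "1 \<le> ?q\<^sup>2"
    using q by simp
  then have "real (?q\<^sup>2 - 1) = real ?q ^ 2 - 1"
    by (simp only: of_nat_diff of_nat_power of_nat_1)
  then show ?thesis
    unfolding T5_eq_card card_reduced_prfs card_monic_prfs[OF pp q] card_quadratic_perms[OF pp]
    by (simp only: of_nat_mult of_nat_add C3 irr) (simp add: power2_eq_square)
qed

theorem theorem3p5:
  fixes q :: nat
  assumes "primepow q"
    and "q > 9"
    and "CARD('a::{field,finite}) = q"
  shows "max_perm_code (q + 1) (q - 5) \<ge> T5 TYPE('a) \<and>
    (q mod 3 = 0 \<longrightarrow>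
       real (T5 TYPE('a)) = 1/2 * (real q ^ 5 + 2 * real q ^ 3 - 3 * real q)) \<and>
    (odd q \<and> q mod 3 = 1 \<longrightarrow>
       real (T5 TYPE('a)) =
         1/2 * (real q ^ 5 - real q ^ 4 + real q ^ 3 + real q ^ 2 - 2 * real q)) \<and>
    (even q \<and> q mod 3 = 1 \<longrightarrow>
       real (T5 TYPE('a)) =
         1/2 * (real q ^ 5 - real q ^ 4 + 3 * real q ^ 3 + real q ^ 2 - 4 * real q)) \<and>
    (odd q \<and> q mod 3 = 2 \<longrightarrow>
       real (T5 TYPE('a)) =
         1/2 * (real q ^ 5 + real q ^ 4 + real q ^ 3 - real q ^ 2 - 2 * real q)) \<and>
    (even q \<and> q mod 3 = 2 \<longrightarrow>
       real (T5 TYPE('a)) =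
         1/2 * (real q ^ 5 + real q ^ 4 + 3 * real q ^ 3 - real q ^ 2 - 4 * real q))"
proof -
  have pp: "primepow CARD('a)" and q: "CARD('a) > 4" "CARD('a) > 5"
    using assms by simp_all
  \<comment> \<open>The case of characteristic 3 carries no parity assumption, so the contribution
    of quadratic polynomials has to be excluded here.\<close>
  have odd: "odd q" if "q mod 3 = 0"
  proof
    assume "even q"
    then have 2: "(2::'a) = 0" and 3: "(3::'a) = 0"
      using two_eq_0_iff[OF pp] three_eq_0_iff[OF pp] that assms(3) by simp_all
    have "(1::'a) = 3 - 2" by simp
    then show False
      unfolding 2 3 by simp
  qed
  define r where "r = real q"
  note T5 = real_T5[OF pp q(1), unfolded assms(3), folded r_def]
  show ?thesis
    unfolding r_def[symmetric]
  proof (intro conjI impI)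
    show "T5 TYPE('a) \<le> max_perm_code (q + 1) (q - 5)"
      using max_perm_code_ge_T5[OF q(2)] unfolding assms(3) .
  next
    assume "q mod 3 = 0"
    then have "real (T5 TYPE('a)) = (r ^ 2 - 1) * (r + r * (r + 1) / 2 + r ^ 2 * (r - 1) / 2)"
      unfolding T5 using odd by simp
    also have "\<dots> = 1/2 * (r ^ 5 + 2 * r ^ 3 - 3 * r)"
      by (simp add: eval_nat_numeral field_simps)
    finally show "real (T5 TYPE('a)) = 1/2 * (r ^ 5 + 2 * r ^ 3 - 3 * r)" .
  next
    assume "odd q \<and> q mod 3 = 1"
    then have "real (T5 TYPE('a)) = (r ^ 2 - 1) * (r + r ^ 2 * (r - 1) / 2)"
      unfolding T5 by simp
    also have "\<dots> = 1/2 * (r ^ 5 - r ^ 4 + r ^ 3 + r ^ 2 - 2 * r)"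
      by (simp add: eval_nat_numeral field_simps)
    finally show "real (T5 TYPE('a)) = 1/2 * (r ^ 5 - r ^ 4 + r ^ 3 + r ^ 2 - 2 * r)" .
  next
    assume "even q \<and> q mod 3 = 1"
    then have "real (T5 TYPE('a)) = (r ^ 2 - 1) * (2 * r + r ^ 2 * (r - 1) / 2)"
      unfolding T5 by simp
    also have "\<dots> = 1/2 * (r ^ 5 - r ^ 4 + 3 * r ^ 3 + r ^ 2 - 4 * r)"
      by (simp add: eval_nat_numeral field_simps)
    finally show "real (T5 TYPE('a)) = 1/2 * (r ^ 5 - r ^ 4 + 3 * r ^ 3 + r ^ 2 - 4 * r)" .
  next
    assume "odd q \<and> q mod 3 = 2"
    then have "real (T5 TYPE('a)) = (r ^ 2 - 1) * (r + r ^ 2 + r ^ 2 * (r - 1) / 2)"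
      unfolding T5 by simp
    also have "\<dots> = 1/2 * (r ^ 5 + r ^ 4 + r ^ 3 - r ^ 2 - 2 * r)"
      by (simp add: eval_nat_numeral field_simps)
    finally show "real (T5 TYPE('a)) = 1/2 * (r ^ 5 + r ^ 4 + r ^ 3 - r ^ 2 - 2 * r)" .
  next
    assume "even q \<and> q mod 3 = 2"
    then have "real (T5 TYPE('a)) = (r ^ 2 - 1) * (2 * r + r ^ 2 + r ^ 2 * (r - 1) / 2)"
      unfolding T5 by simp
    also have "\<dots> = 1/2 * (r ^ 5 + r ^ 4 + 3 * r ^ 3 - r ^ 2 - 4 * r)"
      by (simp add: eval_nat_numeral field_simps)
    finally show "real (T5 TYPE('a)) = 1/2 * (r ^ 5 + r ^ 4 + 3 * r ^ 3 - r ^ 2 - 4 * r)" .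
  qed
qed

end
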